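(* Let $n>1$ and let $P(z)=z^n+c_{n-1}z^{n-1}+\dots+c_1z+c_0\in\mathbb C[z]$. Suppose that the set $B_{P}$ of critical values of $P$ consists of exactly $n-1$ distinct points. Then the braid monodromy group of $P$ is the whole braid group: $\Gamma_{P}=\mathrm{Br}_n$.
   Context: Let $\Pi=\mathbb C$ (the source plane) and let $p_P:\Pi\to\mathbb C$, $w=P(z)$. Let $C_P=\{z: P'(z)=0\}$ be the critical points and $B_P=p_P(C_P)$ the critical values, so $p_P:\Pi\setminus p_P^{-1}(B_P)\to\mathbb C\setminus B_P$ is an unramified $n$-sheeted cover. Fix $w_0\in\mathbb C\setminus B_P$ and let $K=p_P^{-1}(w_0)$ ($n$ distinct points). Denote by $\mathrm{Br}_n[\Pi,K]$ the braid group of the plane with $n$ strands based at $K$ (isotopy classes of $n$ pairwise disjoint paths $(b_j(t),t)$ in $\Pi\times[0,1]$ starting at $K\times\{0\}$ and ending in $K\times\{1\}$), which is isomorphic to the abstract braid group $\mathrm{Br}_n$. For a loop $\lambda$ in $\mathbb C\setminus B_P$ based at $w_0$, the preimage $p_P^{-1}(\lambda)$ consists of $n$ disjoint paths forming a geometric braid $b(\lambda)$; this gives the braid monodromy homomorphism $\beta_P:\pi_1(\mathbb C\setminus B_P,w_0)\to\mathrm{Br}_n[\Pi,K]$, and its image $\Gamma_P$ is the braid monodromy group of $P$. *)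

theory Defs
  imports "HOL-Analysis.Analysis" "HOL-Computational_Algebra.Polynomial"
begin

definition critical_points :: "complex poly \<Rightarrow> complex set" where
  "critical_points p = {z. poly (pderiv p) z = 0}"

definition critical_values :: "complex poly \<Rightarrow> complex set" where
  "critical_values p = poly p ` critical_points p"

definition geom_braid :: "complex set \<Rightarrow> (complex \<Rightarrow> real \<Rightarrow> complex) \<Rightarrow> bool" where
  "geom_braid K b \<longleftrightarrow>
     (\<forall>k\<in>K. path (b k) \<and> b k 0 = k \<and> b k 1 \<in> K) \<and>
     (\<forall>t\<in>{0..1}. \<forall>k\<in>K. \<forall>k'\<in>K. k \<noteq> k' \<longrightarrow> b k t \<noteq> b k' t)"

definition braid_isotopic ::
  "complex set \<Rightarrow> (complex \<Rightarrow> real \<Rightarrow> complex) \<Rightarrow> (complex \<Rightarrow> real \<Rightarrow> complex) \<Rightarrow> bool" where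
  "braid_isotopic K b c \<longleftrightarrow>
     (\<exists>H :: real \<Rightarrow> complex \<Rightarrow> real \<Rightarrow> complex.
        (\<forall>k\<in>K. continuous_on ({0..1} \<times> {0..1}) (\<lambda>(s,t). H s k t)) \<and>
        (\<forall>s\<in>{0..1}. geom_braid K (H s)) \<and>
        (\<forall>k\<in>K. \<forall>t\<in>{0..1}. H 0 k t = b k t \<and> H 1 k t = c k t) \<and>
        (\<forall>s\<in>{0..1}. \<forall>k\<in>K. H s k 1 = b k 1))"

definition braid_class :: "complex set \<Rightarrow> (complex \<Rightarrow> real \<Rightarrow> complex) \<Rightarrow> (complex \<Rightarrow> real \<Rightarrow> complex) set" where
  "braid_class K b = {c. geom_braid K c \<and> braid_isotopic K b c}"

definition braid_group :: "complex set \<Rightarrow> (complex \<Rightarrow> real \<Rightarrow> complex) set set" where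
  "braid_group K = braid_class K ` {b. geom_braid K b}"

definition is_lift :: "complex poly \<Rightarrow> complex set \<Rightarrow> (real \<Rightarrow> complex) \<Rightarrow> (complex \<Rightarrow> real \<Rightarrow> complex) \<Rightarrow> bool" where
  "is_lift p K lam b \<longleftrightarrow>
     (\<forall>k\<in>K. path (b k) \<and> b k 0 = k \<and> (\<forall>t\<in>{0..1}. poly p (b k t) = lam t))"

definition braid_monodromy_group :: "complex poly \<Rightarrow> complex \<Rightarrow> (complex \<Rightarrow> real \<Rightarrow> complex) set set" where
  "braid_monodromy_group p w0 =
     (let K = {z. poly p z = w0} in
      braid_class K ` {b. geom_braid K b \<and>
        (\<exists>lam. path lam \<and> pathstart lam = w0 \<and> pathfinish lam = w0 \<and>
               path_image lam \<inter> critical_values p = {} \<and> is_lift p K lam b)})"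

end

theory Submission
  imports Defs "Jordan_Normal_Form.Determinant" "HOL-Computational_Algebra.Fundamental_Theorem_Algebra"
begin

text \<open>
  A geometric braid based at the roots of \<open>Q = P - w\<^sub>0\<close> is a loop of monic polynomials
  \<open>f\<^sub>t\<close> with simple roots, i.e. with \<open>0\<close> not a critical value of \<open>f\<^sub>t\<close>. The argument is of
  Zariski--van Kampen type: inside the space of pairs \<open>(f, w)\<close> with \<open>w\<close> not a critical value of
  \<open>f\<close>, such a loop is deformed into the fibre over \<open>Q\<close>, where it is a loop \<open>w\<^sub>t\<close> avoiding the
  critical values of \<open>Q\<close>; following the roots of \<open>f - w\<close> turns the deformation into an isotopy.

  Having \<open>n - 1\<close> distinct critical values is the complement of a complex hypersurface, so after
  approximating the strands by polynomials in \<open>t\<close> and moving \<open>t\<close> to a slightly bent arc in the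
  complex plane, every \<open>f\<^sub>t\<close> has \<open>n - 1\<close> distinct critical values. Then the critical values move
  without collision and an ambient isotopy \<open>\<phi>\<^sub>t\<close> of the plane, supported in a disc, carries those of
  \<open>f\<^sub>0\<close> to those of \<open>f\<^sub>t\<close>. Dragging the base point along \<open>\<phi>\<^sub>t\<close> splits the loop into loops in
  the fibre over \<open>Q\<close> and a loop \<open>(f\<^sub>t, w)\<close> with \<open>w\<close> constant and very large; the latter contracts
  because \<open>f\<^sub>t\<close> can be contracted linearly to \<open>Q\<close> while \<open>w\<close> stays beyond all critical values.
\<close>

section \<open>Isotopy of braids\<close>

lemma continuous_on_compose2_prod:
  assumes "continuous_on (S \<times> T) (\<lambda>x. h (fst x) (snd x))" "continuous_on U f" "continuous_on U g"
    and "\<And>x. x \<in> U \<Longrightarrow> f x \<in> S" "\<And>x. x \<in> U \<Longrightarrow> g x \<in> T"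
  shows "continuous_on U (\<lambda>x. h (f x) (g x))"
proof -
  have "continuous_on U (\<lambda>x. h (fst (f x, g x)) (snd (f x, g x)))"
    by (rule continuous_on_compose2[OF assms(1)]) (use assms in \<open>auto intro: continuous_on_Pair\<close>)
  then show ?thesis by simp
qed

lemma braid_isotopic_iff:
  "braid_isotopic K b c \<longleftrightarrow>
     (\<exists>H :: real \<Rightarrow> complex \<Rightarrow> real \<Rightarrow> complex.
        (\<forall>k\<in>K. continuous_on ({0..1} \<times> {0..1}) (\<lambda>x. H (fst x) k (snd x))) \<and>
        (\<forall>s\<in>{0..1}. geom_braid K (H s)) \<and>
        (\<forall>k\<in>K. \<forall>t\<in>{0..1}. H 0 k t = b k t \<and> H 1 k t = c k t) \<and>
        (\<forall>s\<in>{0..1}. \<forall>k\<in>K. H s k 1 = b k 1))"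
  unfolding braid_isotopic_def case_prod_unfold ..

lemma braid_isotopicI:
  fixes H :: "real \<Rightarrow> complex \<Rightarrow> real \<Rightarrow> complex"
  assumes "\<And>k. k \<in> K \<Longrightarrow> continuous_on ({0..1} \<times> {0..1}) (\<lambda>x. H (fst x) k (snd x))"
    and "\<And>s. s \<in> {0..1} \<Longrightarrow> geom_braid K (H s)"
    and "\<And>k t. k \<in> K \<Longrightarrow> t \<in> {0..1} \<Longrightarrow> H 0 k t = b k t"
    and "\<And>k t. k \<in> K \<Longrightarrow> t \<in> {0..1} \<Longrightarrow> H 1 k t = c k t"
    and "\<And>k s. k \<in> K \<Longrightarrow> s \<in> {0..1} \<Longrightarrow> H s k 1 = b k 1"
  shows "braid_isotopic K b c"
  unfolding braid_isotopic_iff using assms by (intro exI[of _ H] conjI ballI) simp_all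

lemma braid_isotopic_sym:
  assumes "braid_isotopic K b c"
  shows "braid_isotopic K c b"
proof -
  obtain H :: "real \<Rightarrow> complex \<Rightarrow> real \<Rightarrow> complex" where H: "\<forall>k\<in>K. continuous_on ({0..1} \<times> {0..1}) (\<lambda>x. H (fst x) k (snd x))"
    "\<forall>s\<in>{0..1}. geom_braid K (H s)"
    "\<forall>k\<in>K. \<forall>t\<in>{0..1}. H 0 k t = b k t \<and> H 1 k t = c k t"
    "\<forall>s\<in>{0..1}. \<forall>k\<in>K. H s k 1 = b k 1"
    using assms unfolding braid_isotopic_iff by blast
  show ?thesis
  proof (rule braid_isotopicI[where H = "\<lambda>s. H (1 - s)"])
    fix k assume "k \<in> K"
    then show "continuous_on ({0..1} \<times> {0..1}) (\<lambda>x. H (1 - fst x) k (snd x))"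
      by (intro continuous_on_compose2_prod[OF H(1)[rule_format]] continuous_intros) auto
  next
    \<comment> \<open>The isotopy pins the end points to those of \<open>b\<close>; evaluating at
      \<open>s = 1\<close> shows that \<open>c\<close> has the same end points.\<close>
    fix k and s :: real assume "k \<in> K" "s \<in> {0..1}"
    then show "H (1 - s) k 1 = c k 1"
      using H(3)[rule_format, of k 1] H(4)[rule_format, of 1 k] H(4)[rule_format, of "1 - s" k] by auto
  qed (use H(2,3) in auto)
qed

lemma braid_isotopic_trans:
  assumes "braid_isotopic K b c" "braid_isotopic K c d"
  shows "braid_isotopic K b d"
proof -
  obtain H :: "real \<Rightarrow> complex \<Rightarrow> real \<Rightarrow> complex" where H: "\<forall>k\<in>K. continuous_on ({0..1} \<times> {0..1}) (\<lambda>x. H (fst x) k (snd x))"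
    "\<forall>s\<in>{0..1}. geom_braid K (H s)"
    "\<forall>k\<in>K. \<forall>t\<in>{0..1}. H 0 k t = b k t \<and> H 1 k t = c k t"
    "\<forall>s\<in>{0..1}. \<forall>k\<in>K. H s k 1 = b k 1"
    using assms(1) unfolding braid_isotopic_iff by blast
  obtain G :: "real \<Rightarrow> complex \<Rightarrow> real \<Rightarrow> complex" where G: "\<forall>k\<in>K. continuous_on ({0..1} \<times> {0..1}) (\<lambda>x. G (fst x) k (snd x))"
    "\<forall>s\<in>{0..1}. geom_braid K (G s)"
    "\<forall>k\<in>K. \<forall>t\<in>{0..1}. G 0 k t = c k t \<and> G 1 k t = d k t"
    "\<forall>s\<in>{0..1}. \<forall>k\<in>K. G s k 1 = c k 1"
    using assms(2) unfolding braid_isotopic_iff by blast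
  define J where "J s = (if s \<le> 1/2 then H (2 * s) else G (2 * s - 1))" for s
  show ?thesis
  proof (rule braid_isotopicI[where H = J])
    fix k assume k: "k \<in> K"
    have 1: "continuous_on ({0..1/2} \<times> {0..1}) (\<lambda>x. H (2 * fst x) k (snd x))"
      using k by (intro continuous_on_compose2_prod[OF H(1)[rule_format]] continuous_intros) auto
    have 2: "continuous_on ({1/2..1} \<times> {0..1}) (\<lambda>x. G (2 * fst x - 1) k (snd x))"
      using k by (intro continuous_on_compose2_prod[OF G(1)[rule_format]] continuous_intros) auto
    have "continuous_on ({0..1/2} \<times> {0..1} \<union> {1/2..1} \<times> {0..1})
      (\<lambda>x. if fst x \<le> 1/2 then H (2 * fst x) k (snd x) else G (2 * fst x - 1) k (snd x))"
    proof (rule continuous_on_cases[OF _ _ 1 2]; (intro closed_Times closed_atLeastAtMost)?)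
      have "H 1 k t = G 0 k t" if "t \<in> {0..1}" for t
        using H(3) G(3) k that by simp
      then show "\<forall>x. x \<in> {0..1/2} \<times> {0..1} \<and> \<not> fst x \<le> 1 / 2 \<or> x \<in> {1/2..1} \<times> {0..1} \<and> fst x \<le> 1 / 2 \<longrightarrow>
        H (2 * fst x) k (snd x) = G (2 * fst x - 1) k (snd x)"
        by (auto simp: antisym_conv mult.commute)
    qed
    moreover have "{0..1/2} \<times> {0..1} \<union> {1/2..1} \<times> {0..1} = {0..1::real} \<times> {0..1::real}" by auto
    ultimately show "continuous_on ({0..1} \<times> {0..1}) (\<lambda>x. J (fst x) k (snd x))"
      by (simp add: J_def if_distribR)
  next
    fix s :: real assume "s \<in> {0..1}"
    then show "geom_braid K (J s)"
      using H(2)[rule_format, of "2 * s"] G(2)[rule_format, of "2 * s - 1"] by (simp add: J_def)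
  next
    fix k and s :: real assume "k \<in> K" "s \<in> {0..1}"
    then show "J s k 1 = b k 1"
      using H(4)[rule_format, of "2 * s" k] H(4)[rule_format, of 1 k] H(3)[rule_format, of k 1]
        G(4)[rule_format, of "2 * s - 1" k] by (simp add: J_def)
  qed (use H(3) G(3) in \<open>simp_all add: J_def\<close>)
qed

lemma braid_class_eq:
  assumes "braid_isotopic K b c"
  shows "braid_class K b = braid_class K c"
  unfolding braid_class_def
  using braid_isotopic_trans[OF assms] braid_isotopic_trans[OF braid_isotopic_sym[OF assms]] by auto

section \<open>Degenerate parameters of polynomial families\<close>

text \<open>The determinant of the system is a polynomial in the parameter. A trivial kernel at
  \<open>a\<close> makes it nonzero at \<open>a\<close>, so it has finitely many roots, and these
  are exactly the parameters with a nontrivial kernel.\<close>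

lemma singular_parameters_finite:
  fixes A :: "nat \<Rightarrow> nat \<Rightarrow> complex poly"
  assumes "\<And>v. (\<And>j. j < N \<Longrightarrow> (\<Sum>i<N. poly (A j i) a * v i) = 0) \<Longrightarrow> (\<forall>i<N. v i = 0)"
  shows "finite {x. \<exists>v. (\<exists>i<N. v i \<noteq> 0) \<and> (\<forall>j<N. (\<Sum>i<N. poly (A j i) x * v i) = 0)}"
proof -
  define M where "M = Matrix.mat N N (\<lambda>(j, i). A j i)"
  define E where "E x = Matrix.mat N N (\<lambda>(j, i). poly (A j i) x)" for x
  have det_E: "Determinant.det (E x) = poly (Determinant.det M) x" for x
  proof -
    \<comment> \<open>Evaluation at \<open>x\<close> is a ring homomorphism, so it commutes with the
      determinant.\<close>
    interpret ev: comm_ring_hom "\<lambda>p. poly p x" by unfold_locales auto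
    have "E x = map_mat (\<lambda>p. poly p x) M" by (auto simp: E_def M_def)
    then show ?thesis by (simp only: ev.hom_det)
  qed
  have E_mult: "(E x *\<^sub>v w = 0\<^sub>v N) \<longleftrightarrow> (\<forall>j<N. (\<Sum>i<N. poly (A j i) x * vec_index w i) = 0)"
    if "w \<in> carrier_vec N" for x w
  proof -
    have "vec_index (E x *\<^sub>v w) j = (\<Sum>i<N. poly (A j i) x * vec_index w i)" if "j < N" for j
      using that \<open>w \<in> carrier_vec N\<close>
      by (auto simp: E_def scalar_prod_def lessThan_atLeast0 intro!: sum.cong)
    moreover have "dim_vec (E x *\<^sub>v w) = N" by (simp add: E_def)
    ultimately show ?thesis by (auto simp: vec_eq_iff)
  qed
  have det_0: "Determinant.det (E x) = 0 \<longleftrightarrow>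
    (\<exists>v. (\<exists>i<N. v i \<noteq> 0) \<and> (\<forall>j<N. (\<Sum>i<N. poly (A j i) x * v i) = 0))" for x
  proof -
    have "E x \<in> carrier_mat N N" by (simp add: E_def)
    from det_0_iff_vec_prod_zero_field[OF this]
    have "Determinant.det (E x) = 0 \<longleftrightarrow>
      (\<exists>w. w \<in> carrier_vec N \<and> w \<noteq> 0\<^sub>v N \<and> E x *\<^sub>v w = 0\<^sub>v N)" .
    also have "\<dots> \<longleftrightarrow> (\<exists>v. (\<exists>i<N. v i \<noteq> 0) \<and> (\<forall>j<N. (\<Sum>i<N. poly (A j i) x * v i) = 0))"
    proof safe
      fix w assume w: "w \<in> carrier_vec N" "w \<noteq> 0\<^sub>v N" "E x *\<^sub>v w = 0\<^sub>v N"
      then have "\<exists>i<N. vec_index w i \<noteq> 0" by (auto simp: vec_eq_iff)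
      with w E_mult show "\<exists>v. (\<exists>i<N. v i \<noteq> 0) \<and> (\<forall>j<N. (\<Sum>i<N. poly (A j i) x * v i) = 0)"
        by (intro exI[of _ "vec_index w"]) auto
    next
      fix v i assume v: "\<forall>j<N. (\<Sum>i<N. poly (A j i) x * v i) = 0" "i < N" "v i \<noteq> 0"
      have "Matrix.vec N v \<in> carrier_vec N" by simp
      moreover have "Matrix.vec N v \<noteq> 0\<^sub>v N" using v by (auto simp: vec_eq_iff)
      moreover have "E x *\<^sub>v Matrix.vec N v = 0\<^sub>v N" using v E_mult[of "Matrix.vec N v" x] by auto
      ultimately show "\<exists>w. w \<in> carrier_vec N \<and> w \<noteq> 0\<^sub>v N \<and> E x *\<^sub>v w = 0\<^sub>v N" by blast
    qed
    finally show ?thesis .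
  qed
  have "Determinant.det (E a) \<noteq> 0" unfolding det_0 using assms by blast
  then have "Determinant.det M \<noteq> 0" using det_E[of a] by auto
  then have "finite {x. poly (Determinant.det M) x = 0}" by (rule poly_roots_finite)
  then show ?thesis by (simp only: det_0[symmetric] det_E)
qed

text \<open>Over the complex numbers both polynomials split into linear factors, so divisibility is
  inclusion of root multisets.\<close>

lemma dvd_if_order_le:
  fixes p q :: "complex poly"
  assumes "p \<noteq> 0" and "\<And>x. poly p x = 0 \<Longrightarrow> q = 0 \<or> order x p \<le> order x q"
  shows "p dvd q"
proof -
  have "proots p \<subseteq># proots q" if "q \<noteq> 0"
    unfolding subseteq_mset_def
  proof
    fix a show "count (proots p) a \<le> count (proots q) a"
      using assms that by (cases "poly p a = 0") (auto simp: order_0I)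
  qed
  then have "(\<Prod>x\<in>#proots p. [:-x, 1:]) dvd (\<Prod>x\<in>#proots q. [:-x, 1:])" if "q \<noteq> 0"
    using that by (intro prod_mset_subset_imp_dvd image_mset_subseteq_mono) auto
  then have "Polynomial.smult (lead_coeff p) (\<Prod>x\<in>#proots p. [:-x, 1:])
      dvd Polynomial.smult (lead_coeff q) (\<Prod>x\<in>#proots q. [:-x, 1:])" if "q \<noteq> 0"
    using that assms(1) by (auto intro!: smult_dvd dvd_smult)
  then show ?thesis by (cases "q = 0") (auto simp: complex_poly_decompose_multiset)
qed

section \<open>Polynomials whose coefficients are polynomial in a complex parameter\<close>

definition poly_family :: "(complex \<Rightarrow> complex poly) \<Rightarrow> bool" where
  "poly_family f \<longleftrightarrow> (\<forall>i. \<exists>c. \<forall>x. coeff (f x) i = poly c x)"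

lemma poly_family_const: "poly_family (\<lambda>x. p)"
  unfolding poly_family_def by (auto intro: exI[of _ "[:_:]"])

lemma poly_family_mult:
  assumes "poly_family f" "poly_family g"
  shows "poly_family (\<lambda>x. f x * g x)"
proof -
  obtain c d where c: "\<And>i x. coeff (f x) i = poly (c i) x" and d: "\<And>i x. coeff (g x) i = poly (d i) x"
    using assms unfolding poly_family_def by metis
  show ?thesis unfolding poly_family_def
  proof
    fix i show "\<exists>e. \<forall>x. coeff (f x * g x) i = poly e x"
      by (rule exI[of _ "\<Sum>k\<le>i. c k * d (i - k)"]) (simp add: coeff_mult c d poly_sum)
  qed
qed

lemma poly_family_power: "poly_family f \<Longrightarrow> poly_family (\<lambda>x. f x ^ i)"
  by (induction i) (auto intro: poly_family_const poly_family_mult)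

lemma poly_family_prod: "(\<And>k. k \<in> K \<Longrightarrow> poly_family (f k)) \<Longrightarrow> poly_family (\<lambda>x. \<Prod>k\<in>K. f k x)"
  by (induction K rule: infinite_finite_induct) (auto intro: poly_family_const poly_family_mult)

lemma poly_family_pderiv: 
  assumes "poly_family f" shows "poly_family (\<lambda>x. pderiv (f x))"
proof -
  obtain c where c: "\<And>i x. coeff (f x) i = poly (c i) x"
    using assms unfolding poly_family_def by metis
  show ?thesis unfolding poly_family_def
  proof
    fix i show "\<exists>e. \<forall>x. coeff (pderiv (f x)) i = poly e x"
      by (rule exI[of _ "Polynomial.smult (of_nat (Suc i)) (c (Suc i))"]) (simp add: coeff_pderiv c)
  qed
qed

lemma poly_family_linear: "poly_family (\<lambda>x. [:- poly b x, 1:])"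
  unfolding poly_family_def
proof
  fix i show "\<exists>c. \<forall>x. coeff [:- poly b x, 1:] i = poly c x"
    by (cases i; cases "i - 1") (auto intro: exI[of _ "- b"] exI[of _ 1] exI[of _ 0])
qed

section \<open>Critical points and critical values of a single polynomial\<close>

lemma pderiv_nonzero: "degree (f :: complex poly) > 0 \<Longrightarrow> pderiv f \<noteq> 0"
  by (auto simp: pderiv_eq_0_iff)

lemma finite_critical_points: "degree f > 0 \<Longrightarrow> finite (critical_points f)"
  unfolding critical_points_def by (intro poly_roots_finite pderiv_nonzero)

lemma card_critical_points_le: "degree f > 0 \<Longrightarrow> card (critical_points f) \<le> degree f - 1"
  using card_poly_roots_bound[of "pderiv f"] pderiv_nonzero[of f]
  by (auto simp: critical_points_def degree_pderiv)

lemma finite_critical_values: "degree f > 0 \<Longrightarrow> finite (critical_values f)"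
  unfolding critical_values_def by (intro finite_imageI finite_critical_points)

lemma card_critical_values_le: "degree f > 0 \<Longrightarrow> card (critical_values f) \<le> degree f - 1"
  unfolding critical_values_def
  by (rule order_trans[OF card_image_le[OF finite_critical_points] card_critical_points_le])

text \<open>A zero of order \<open>k\<close> of \<open>pderiv f\<close> is a zero of order \<open>k + 1\<close> of \<open>f - v\<close> for the
  corresponding critical value \<open>v\<close>.\<close>

lemma pderiv_dvd_prod_critical_values:
  assumes "degree f > 0"
  shows "pderiv f dvd (\<Prod>v\<in>critical_values f. f - [:v:])"
proof (rule dvd_if_order_le)
  show "pderiv f \<noteq> 0" using assms by (rule pderiv_nonzero)
  fix x assume x: "poly (pderiv f) x = 0"
  define v where "v = poly f x"
  have fv: "f - [:v:] \<noteq> 0" using assms by (metis degree_pCons_0 eq_iff_diff_eq_0 less_numeral_extra(3))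
  have "v \<in> critical_values f" using x by (auto simp: v_def critical_values_def critical_points_def)
  then have "(f - [:v:]) dvd (\<Prod>v\<in>critical_values f. f - [:v:])"
    using finite_critical_values[OF assms] by (rule dvd_prodI[rotated])
  moreover have "pderiv (f - [:v:]) = pderiv f" by (simp add: pderiv_diff pderiv_pCons)
  moreover have "order x (f - [:v:]) = Suc (order x (pderiv (f - [:v:])))"
    using fv pderiv_nonzero[OF assms] by (intro order_pderiv) (auto simp: v_def pderiv_diff pderiv_pCons order_root)
  ultimately show "(\<Prod>v\<in>critical_values f. f - [:v:]) = 0 \<or>
      order x (pderiv f) \<le> order x (\<Prod>v\<in>critical_values f. f - [:v:])"
    using dvd_imp_order_le[of "\<Prod>v\<in>critical_values f. f - [:v:]" "f - [:v:]" x] by fastforce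
qed

text \<open>At a critical point the right-hand side vanishes, so the polynomial with coefficients
  \<open>v i\<close>, of degree below \<open>m\<close>, vanishes at all \<open>m\<close> critical
  values and is zero. Then \<open>pderiv f * h = 0\<close> leaves only \<open>h = 0\<close>.\<close>

lemma critical_values_relation_trivial:
  assumes n: "degree f = Suc m" "m > 0" and good: "card (critical_values f) = m"
    and rel: "(\<Sum>i<m. Polynomial.smult (v i) (f ^ i)) = pderiv f * h"
  shows "(\<forall>i<m. v i = 0) \<and> h = 0"
proof -
  define c where "c = (\<Sum>i<m. monom (v i) i)"
  have coeff_c: "coeff c i = (if i < m then v i else 0)" for i
    by (auto simp: c_def coeff_sum if_distrib[of "\<lambda>x. x * _"] cong: if_cong)
  have "poly c w = 0" if "w \<in> critical_values f" for w
  proof -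
    from that obtain x where x: "poly (pderiv f) x = 0" "w = poly f x"
      by (auto simp: critical_values_def critical_points_def)
    have "poly (\<Sum>i<m. Polynomial.smult (v i) (f ^ i)) x = poly c w"
      by (simp add: c_def x(2) poly_sum poly_monom)
    then show ?thesis using x by (simp add: rel)
  qed
  then have sub: "critical_values f \<subseteq> {w. poly c w = 0}" by auto
  have "c = 0"
  proof (rule ccontr)
    assume "c \<noteq> 0"
    then have "m \<le> degree c"
      using card_mono[OF poly_roots_finite sub] card_poly_roots_bound[of c] good by fastforce
    moreover have "degree c < m"
      using coeff_c[of "degree c"] \<open>c \<noteq> 0\<close> by (metis leading_coeff_0_iff)
    ultimately show False by simp
  qed
  then have "\<forall>i<m. v i = 0" using coeff_c by (metis coeff_0)
  moreover have "h = 0" using rel \<open>\<forall>i<m. v i = 0\<close> pderiv_nonzero[of f] n by simp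
  ultimately show ?thesis by blast
qed

text \<open>With fewer than \<open>m\<close> critical values, the monic polynomial \<open>c\<close>
  whose roots they are has degree below \<open>m\<close>. Substituting \<open>f\<close> into it
  gives a multiple of \<open>pderiv f\<close>, and the coefficients of \<open>c\<close> are the
  relation.\<close>

lemma critical_values_relation_exists:
  assumes n: "degree f = Suc m" "m > 0" and bad: "card (critical_values f) \<noteq> m"
  obtains v h where "(\<Sum>i<m. Polynomial.smult (v i) (f ^ i)) = pderiv f * h" "\<exists>i<m. v i \<noteq> 0"
    "degree h < m * m - m \<or> h = 0"
proof -
  define c where "c = (\<Prod>v\<in>critical_values f. [:- v, 1:])"
  have fin: "finite (critical_values f)" using n by (intro finite_critical_values) auto
  have deg_c: "degree c = card (critical_values f)"
    unfolding c_def by (subst degree_prod_eq_sum_degree) auto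
  also have "\<dots> < m" using card_critical_values_le[of f] n bad by simp
  finally have "degree c < m" .
  have "c \<noteq> 0" using fin by (auto simp: c_def)
  have comp: "pcompose c f = (\<Prod>v\<in>critical_values f. f - [:v:])"
    unfolding c_def pcompose_prod by (intro prod.cong) (auto simp: pcompose_pCons)
  then obtain h where h: "pcompose c f = pderiv f * h"
    using pderiv_dvd_prod_critical_values[of f] n by (auto elim: dvdE)
  have "pcompose c f = (\<Sum>i\<le>degree c. Polynomial.smult (coeff c i) (f ^ i))"
    by (subst poly_eq_poly_eq_iff[symmetric]) (simp add: fun_eq_iff poly_pcompose poly_sum poly_altdef[of c])
  also have "\<dots> = (\<Sum>i<m. Polynomial.smult (coeff c i) (f ^ i))"
    using \<open>degree c < m\<close> by (intro sum.mono_neutral_left) (auto simp: coeff_eq_0)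
  finally have "(\<Sum>i<m. Polynomial.smult (coeff c i) (f ^ i)) = pderiv f * h" using h by simp
  moreover have "\<exists>i<m. coeff c i \<noteq> 0"
    using \<open>degree c < m\<close> \<open>c \<noteq> 0\<close> by (metis leading_coeff_0_iff)
  \<comment> \<open>Comparing degrees, \<open>m + degree h = degree c * (m + 1)\<close> is at most
    \<open>(m - 1) * (m + 1) = m * m - 1\<close>.\<close>
  moreover have "degree h < m * m - m" if "h \<noteq> 0"
  proof -
    have "m + degree h = degree c * Suc m"
      using arg_cong[OF h, of degree] n that pderiv_nonzero[of f]
      by (simp add: degree_pcompose degree_mult_eq degree_pderiv)
    also have "\<dots> \<le> (m - 1) * Suc m" using \<open>degree c < m\<close> by (intro mult_right_mono) auto
    also have "\<dots> < m * m" using n by (cases m) auto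
    finally show ?thesis by simp
  qed
  ultimately show ?thesis using that by blast
qed

text \<open>The critical values are distinct iff \<open>1, f, \<dots>, f ^ (m - 1)\<close> are linearly independent modulo
  \<open>pderiv f\<close>. By degree considerations this is the non-vanishing of the determinant with columns
  \<open>f ^ i\<close> (\<open>i < m\<close>) and \<open>pderiv f * z ^ j\<close> (\<open>j < m * m - m\<close>), a polynomial in the parameter.\<close>

lemma degenerate_parameters_finite:
  assumes "poly_family f" and deg: "\<And>x. degree (f x) = Suc m" and "m > 0"
    and "card (critical_values (f a)) = m"
  shows "finite {x. card (critical_values (f x)) \<noteq> m}"
proof -
  define col where "col x i = (if i < m then f x ^ i else pderiv (f x) * monom 1 (i - m))" for x i
  have "poly_family (\<lambda>x. col x i)" for i
    unfolding col_def using assms(1)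
    by (cases "i < m") (auto intro!: poly_family_mult poly_family_power poly_family_pderiv poly_family_const)
  then have ex: "\<exists>c. \<forall>x. coeff (col x i) j = poly c x" for i j by (simp add: poly_family_def)
  define A where "A j i = (SOME c. \<forall>x. coeff (col x i) j = poly c x)" for i j
  have A: "coeff (col x i) j = poly (A j i) x" for i j x
    using someI_ex[OF ex[of i j]] unfolding A_def by blast
  have mm: "m \<le> m * m" by (cases m) auto
  \<comment> \<open>Powers of \<open>f x\<close> have degree at most
    \<open>(m + 1) * (m - 1) = m * m - 1\<close>, and so have the multiples of the derivative. Hence
    \<open>m * m\<close> coefficient equations suffice and the system is square.\<close>
  have deg_col: "degree (col x i) < m * m" if "i < m * m" for x i
  proof (cases "i < m")
    case True
    then have "Suc m * i \<le> Suc m * (m - 1)" by (intro mult_left_mono) auto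
    also have "\<dots> < m * m" using \<open>m > 0\<close> by (cases m) auto
    finally have "Suc m * i < m * m" .
    with True show ?thesis using degree_power_le[of "f x" i] by (simp add: col_def deg)
  next
    case False
    have "degree (col x i) \<le> m + (i - m)"
      using False degree_mult_le[of "pderiv (f x)" "monom 1 (i - m)"]
      by (simp add: col_def degree_pderiv deg degree_monom_eq)
    then show ?thesis using False that by simp
  qed
  have split: "(\<Sum>i<m*m. Polynomial.smult (v i) (col x i)) =
      (\<Sum>i<m. Polynomial.smult (v i) (f x ^ i)) + pderiv (f x) * (\<Sum>i<m*m-m. monom (v (i + m)) i)" for v x
  proof -
    have "(\<Sum>i<m*m. Polynomial.smult (v i) (col x i)) =
      (\<Sum>i<m. Polynomial.smult (v i) (col x i)) + (\<Sum>i=m..<m*m. Polynomial.smult (v i) (col x i))"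
      unfolding lessThan_atLeast0 using mm by (intro sum.atLeastLessThan_concat[symmetric]) auto
    also have "(\<Sum>i=m..<m*m. Polynomial.smult (v i) (col x i)) =
        (\<Sum>i=0..<m*m-m. Polynomial.smult (v (i + m)) (col x (i + m)))"
      using mm sum.shift_bounds_nat_ivl[of "\<lambda>i. Polynomial.smult (v i) (col x i)" 0 m "m*m-m"] by simp
    also have "\<dots> = pderiv (f x) * (\<Sum>i<m*m-m. monom (v (i + m)) i)"
      unfolding lessThan_atLeast0 sum_distrib_left
      by (intro sum.cong) (auto simp: col_def smult_monom simp flip: mult_smult_right)
    finally show ?thesis by (simp add: col_def)
  qed
  have eqs: "(\<forall>j<m*m. (\<Sum>i<m*m. poly (A j i) x * v i) = 0) \<longleftrightarrow>
      (\<Sum>i<m*m. Polynomial.smult (v i) (col x i)) = 0" (is "?L = (?S = 0)") for x v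
  proof -
    have c: "coeff ?S j = (\<Sum>i<m*m. poly (A j i) x * v i)" for j
      unfolding coeff_sum coeff_smult A by (simp only: mult.commute)
    have "coeff ?S j = 0" if "j \<ge> m * m" for j
    proof -
      have "coeff (col x i) j = 0" if "i < m * m" for i
        using deg_col[OF that, of x] \<open>j \<ge> m * m\<close> by (intro coeff_eq_0) auto
      then show ?thesis by (simp add: coeff_sum)
    qed
    then have "?S = 0 \<longleftrightarrow> (\<forall>j<m*m. coeff ?S j = 0)"
      unfolding poly_eq_iff coeff_0 by (meson not_le)
    then show ?thesis unfolding c by blast
  qed
  have "\<forall>i<m*m. v i = 0" if "\<And>j. j < m*m \<Longrightarrow> (\<Sum>i<m*m. poly (A j i) a * v i) = 0" for v
  proof -
    let ?h = "\<Sum>i<m*m-m. monom (v (i + m)) i"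
    have "(\<Sum>i<m. Polynomial.smult (v i) (f a ^ i)) = pderiv (f a) * (- ?h)"
      using eqs[of a v] that by (simp add: split eq_neg_iff_add_eq_0)
    from critical_values_relation_trivial[OF deg assms(3,4) this]
    have *: "\<forall>i<m. v i = 0" "?h = 0" by auto
    have "v (i + m) = 0" if "i < m * m - m" for i
      using arg_cong[OF *(2), of "\<lambda>q. coeff q i"] that by (simp add: coeff_sum)
    then have "v i = 0" if "i < m * m" "i \<ge> m" for i
      using that(2) by (metis diff_less_mono le_add_diff_inverse2 that(1))
    then show ?thesis using *(1) by (meson not_le)
  qed
  from singular_parameters_finite[where A = A and a = a, OF this]
  have fin: "finite {x. \<exists>v. (\<exists>i<m*m. v i \<noteq> 0) \<and> (\<Sum>i<m*m. Polynomial.smult (v i) (col x i)) = 0}"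
    by (simp add: eqs)
  show ?thesis
  proof (rule finite_subset[OF _ fin], safe)
    fix x assume "card (critical_values (f x)) \<noteq> m"
    from critical_values_relation_exists[OF deg assms(3) this] obtain v h where
      vh: "(\<Sum>i<m. Polynomial.smult (v i) (f x ^ i)) = pderiv (f x) * h" "\<exists>i<m. v i \<noteq> 0"
        "degree h < m * m - m \<or> h = 0" by blast
    \<comment> \<open>A relation becomes a kernel vector: its coefficients \<open>v\<close>,
      followed by the coefficients of \<open>- h\<close>.\<close>
    define u where "u i = (if i < m then v i else - coeff h (i - m))" for i
    have "(\<Sum>i<m*m-m. monom (u (i + m)) i) = - h"
      using vh(3) by (cases "h = 0") (auto simp: poly_eq_iff[of _ "- h"] u_def coeff_sum coeff_eq_0)
    then have "(\<Sum>i<m*m. Polynomial.smult (u i) (col x i)) = 0"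
      unfolding split using vh(1) by (simp add: u_def)
    moreover from vh(2) obtain i where "i < m" "v i \<noteq> 0" by blast
    then have "\<exists>i<m*m. u i \<noteq> 0" using mm by (metis less_le_trans u_def)
    ultimately show "\<exists>v. (\<exists>i<m*m. v i \<noteq> 0) \<and> (\<Sum>i<m*m. Polynomial.smult (v i) (col x i)) = 0" by blast
  qed
qed

section \<open>Continuity of simple roots\<close>

text \<open>Together with a fixed degree, coefficientwise continuity gives continuity of evaluation
  at a moving point (\<open>continuous_on_poly_family\<close>).\<close>

definition coeffs_continuous_on :: "'a::topological_space set \<Rightarrow> ('a \<Rightarrow> complex poly) \<Rightarrow> bool" where
  "coeffs_continuous_on S F \<longleftrightarrow> (\<forall>i. continuous_on S (\<lambda>x. coeff (F x) i))"

lemma coeffs_continuous_on_const: "coeffs_continuous_on S (\<lambda>x. p)"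
  by (simp add: coeffs_continuous_on_def)

lemma coeffs_continuous_on_add:
  "coeffs_continuous_on S F \<Longrightarrow> coeffs_continuous_on S G \<Longrightarrow> coeffs_continuous_on S (\<lambda>x. F x + G x)"
  by (auto simp: coeffs_continuous_on_def intro!: continuous_intros)

lemma coeffs_continuous_on_diff:
  "coeffs_continuous_on S F \<Longrightarrow> coeffs_continuous_on S G \<Longrightarrow> coeffs_continuous_on S (\<lambda>x. F x - G x)"
  by (auto simp: coeffs_continuous_on_def intro!: continuous_intros)

lemma coeffs_continuous_on_smult:
  "continuous_on S f \<Longrightarrow> coeffs_continuous_on S G \<Longrightarrow> coeffs_continuous_on S (\<lambda>x. Polynomial.smult (f x) (G x))"
  by (auto simp: coeffs_continuous_on_def intro!: continuous_intros)

lemma coeffs_continuous_on_mult: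
  "coeffs_continuous_on S F \<Longrightarrow> coeffs_continuous_on S G \<Longrightarrow> coeffs_continuous_on S (\<lambda>x. F x * G x)"
  by (auto simp: coeffs_continuous_on_def coeff_mult intro!: continuous_intros)

lemma coeffs_continuous_on_prod:
  "(\<And>k. k \<in> K \<Longrightarrow> coeffs_continuous_on S (F k)) \<Longrightarrow> coeffs_continuous_on S (\<lambda>x. \<Prod>k\<in>K. F k x)"
  by (induction K rule: infinite_finite_induct)
    (auto intro: coeffs_continuous_on_const coeffs_continuous_on_mult)

lemma coeffs_continuous_on_pCons:
  "continuous_on S f \<Longrightarrow> coeffs_continuous_on S (\<lambda>x. pCons (f x) p)"
  unfolding coeffs_continuous_on_def coeff_pCons
proof
  fix i assume "continuous_on S f"
  then show "continuous_on S (\<lambda>x. case i of 0 \<Rightarrow> f x | Suc j \<Rightarrow> coeff p j)" by (cases i) auto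
qed

lemma coeffs_continuous_on_pderiv:
  "coeffs_continuous_on S F \<Longrightarrow> coeffs_continuous_on S (\<lambda>x. pderiv (F x))"
  by (auto simp: coeffs_continuous_on_def coeff_pderiv intro!: continuous_intros)

lemma coeffs_continuous_on_compose:
  "coeffs_continuous_on S F \<Longrightarrow> continuous_on T f \<Longrightarrow> f ` T \<subseteq> S \<Longrightarrow> coeffs_continuous_on T (\<lambda>x. F (f x))"
  unfolding coeffs_continuous_on_def by (auto intro: continuous_on_compose2)

lemma continuous_on_poly_family:
  assumes "coeffs_continuous_on S F" "continuous_on S g" "\<And>x. x \<in> S \<Longrightarrow> degree (F x) = n"
  shows "continuous_on S (\<lambda>x. poly (F x) (g x))"
proof -
  have "continuous_on S (\<lambda>x. \<Sum>i\<le>n. coeff (F x) i * g x ^ i)"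
    using assms by (auto simp: coeffs_continuous_on_def intro!: continuous_intros)
  moreover have "(\<Sum>i\<le>n. coeff (F x) i * g x ^ i) = poly (F x) (g x)" if "x \<in> S" for x
    using assms(3)[OF that] by (simp add: poly_altdef)
  ultimately show ?thesis by (simp cong: continuous_on_cong)
qed

section \<open>Roots close to approximate zeros\<close>

lemma norm_prod_mset_ge:
  fixes A :: "complex multiset"
  assumes "\<And>x. x \<in># A \<Longrightarrow> e \<le> norm (z - x)" "e \<ge> 0"
  shows "e ^ size A \<le> norm (\<Prod>x\<in>#A. z - x)"
  using assms
proof (induction A)
  case (add a A)
  then show ?case by (auto simp: norm_mult intro!: mult_mono)
qed auto

text \<open>If every root were at distance at least \<open>e\<close> from \<open>z\<close>, the
  factorization of \<open>p\<close> would bound \<open>norm (poly p z)\<close> from below by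
  \<open>norm (lead_coeff p) * e ^ degree p\<close>.\<close>

lemma root_near:
  fixes p :: "complex poly"
  assumes "norm (poly p z) < norm (lead_coeff p) * e ^ degree p" "e > 0"
  shows "\<exists>r. poly p r = 0 \<and> dist r z < e"
proof (rule ccontr)
  assume *: "\<not> ?thesis"
  have "p \<noteq> 0" using assms by auto
  have "poly p z = poly (Polynomial.smult (lead_coeff p) (\<Prod>x\<in>#proots p. [:-x, 1:])) z"
    by (simp only: complex_poly_decompose_multiset)
  also have "\<dots> = lead_coeff p * (\<Prod>x\<in>#proots p. z - x)"
    by (simp add: poly_prod_mset image_mset.compositionality o_def)
  finally have eq: "poly p z = lead_coeff p * (\<Prod>x\<in>#proots p. z - x)" .
  have "e ^ size (proots p) \<le> norm (\<Prod>x\<in>#proots p. z - x)"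
    using * \<open>p \<noteq> 0\<close> assms(2)
    by (intro norm_prod_mset_ge) (auto simp: dist_norm norm_minus_commute not_less set_count_proots)
  then have "norm (lead_coeff p) * e ^ degree p \<le> norm (poly p z)"
    unfolding eq norm_mult size_proots_complex by (intro mult_left_mono) auto
  with assms show False by simp
qed

text \<open>Having \<open>n\<close> distinct roots at every parameter is the braid condition in
  terms of polynomials. The fixed leading coefficient makes the bound of \<open>root_near\<close>
  the same for all parameters.\<close>

locale simple_root_family =
  fixes S :: "'a::real_normed_vector set" and F :: "'a \<Rightarrow> complex poly" and n :: nat and c :: complex
  assumes cont: "coeffs_continuous_on S F"
    and deg: "x \<in> S \<Longrightarrow> degree (F x) = n"
    and lead: "x \<in> S \<Longrightarrow> lead_coeff (F x) = c"
    and n_pos: "n > 0" and c_nz: "c \<noteq> 0"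
    and simple: "x \<in> S \<Longrightarrow> card {z. poly (F x) z = 0} = n"
begin

text \<open>The incidence set of parameters and roots, whose projection to \<open>S\<close> will be
  the covering with the roots as sheets.\<close>

definition total :: "('a \<times> complex) set" where
  "total = {(x, z). x \<in> S \<and> poly (F x) z = 0}"

lemma finite_roots: "x \<in> S \<Longrightarrow> finite {z. poly (F x) z = 0}"
  by (metis lead c_nz leading_coeff_0_iff poly_roots_finite)

text \<open>At the fixed point \<open>r\<close> the value \<open>poly (F x) r\<close> is small for
  \<open>x\<close> near \<open>x0\<close>, so \<open>root_near\<close> supplies a root close to
  \<open>r\<close>.\<close>

lemma root_persists:
  assumes "x0 \<in> S" "poly (F x0) r = 0" "e > 0"
  shows "\<exists>d>0. \<forall>x\<in>S. dist x x0 < d \<longrightarrow> (\<exists>z. poly (F x) z = 0 \<and> dist z r < e)"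
proof -
  have "continuous_on S (\<lambda>x. poly (F x) r)"
    using cont deg by (intro continuous_on_poly_family) auto
  moreover have "norm c * e ^ n > 0" using c_nz assms by simp
  ultimately obtain d where d: "d > 0"
    "\<And>x. x \<in> S \<Longrightarrow> dist x x0 < d \<Longrightarrow> dist (poly (F x) r) (poly (F x0) r) < norm c * e ^ n"
    using assms(1) unfolding continuous_on_iff by blast
  have "\<exists>z. poly (F x) z = 0 \<and> dist z r < e" if "x \<in> S" "dist x x0 < d" for x
    using d(2)[OF that] assms(2,3) root_near[of "F x" r e]
    unfolding deg[OF that(1)] lead[OF that(1), unfolded deg[OF that(1)]] by simp
  with d(1) show ?thesis by blast
qed

text \<open>Each of the \<open>n\<close> disjoint discs around the roots of \<open>F x0\<close>
  contains a root of \<open>F x\<close> for \<open>x\<close> near \<open>x0\<close>. As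
  \<open>F x\<close> has only \<open>n\<close> roots, each disc contains exactly one and no root
  lies elsewhere.\<close>

lemma root_isolation:
  assumes "x0 \<in> S"
  obtains e d where "e > 0" "d > 0"
    "\<And>r r'. poly (F x0) r = 0 \<Longrightarrow> poly (F x0) r' = 0 \<Longrightarrow> r \<noteq> r' \<Longrightarrow> ball r e \<inter> ball r' e = {}"
    "\<And>x r. x \<in> S \<Longrightarrow> dist x x0 < d \<Longrightarrow> poly (F x0) r = 0 \<Longrightarrow> \<exists>!z. poly (F x) z = 0 \<and> z \<in> ball r e"
    "\<And>x z. x \<in> S \<Longrightarrow> dist x x0 < d \<Longrightarrow> poly (F x) z = 0 \<Longrightarrow> \<exists>r. poly (F x0) r = 0 \<and> z \<in> ball r e"
proof -
  define R where "R = {r. poly (F x0) r = 0}"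
  have fin: "finite R" unfolding R_def using assms by (rule finite_roots)
  have "\<exists>e>0. \<forall>r'\<in>R. r \<noteq> r' \<longrightarrow> e \<le> dist r r'" for r
    using finite_set_avoid[OF fin, of r] by metis
  then obtain sep where sep: "\<And>r. sep r > 0" "\<And>r r'. r' \<in> R \<Longrightarrow> r \<noteq> r' \<Longrightarrow> sep r \<le> dist r r'"
    by metis
  \<comment> \<open>Half the smallest separation makes the discs disjoint; the inserted 1 keeps the
    minimum over a nonempty set.\<close>
  define e where "e = Min (insert 1 (sep ` R)) / 2"
  have "e > 0" using fin sep(1) by (auto simp: e_def)
  have disj: "ball r e \<inter> ball r' e = {}" if "r \<in> R" "r' \<in> R" "r \<noteq> r'" for r r'
  proof -
    have "2 * e \<le> sep r" using that fin by (auto simp: e_def)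
    also have "\<dots> \<le> dist r r'" using that by (intro sep) auto
    finally show ?thesis by (intro disjoint_ballI) auto
  qed
  have "\<forall>r\<in>R. \<exists>d>0. \<forall>x\<in>S. dist x x0 < d \<longrightarrow> (\<exists>z. poly (F x) z = 0 \<and> dist z r < e)"
    using root_persists[OF assms _ \<open>e > 0\<close>] by (auto simp: R_def)
  then obtain D where D: "\<And>r. r \<in> R \<Longrightarrow> D r > 0"
    "\<And>r x. r \<in> R \<Longrightarrow> x \<in> S \<Longrightarrow> dist x x0 < D r \<Longrightarrow> \<exists>z. poly (F x) z = 0 \<and> dist z r < e"
    by metis
  define d where "d = Min (insert 1 (D ` R))"
  have "d > 0" using fin D(1) by (auto simp: d_def)
  have d_le: "d \<le> D r" if "r \<in> R" for r using fin that by (auto simp: d_def)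
  have main: "(\<forall>r\<in>R. \<exists>!z. poly (F x) z = 0 \<and> z \<in> ball r e) \<and> (\<forall>z. poly (F x) z = 0 \<longrightarrow> (\<exists>r\<in>R. z \<in> ball r e))"
    if x: "x \<in> S" "dist x x0 < d" for x
  proof -
    have "\<forall>r\<in>R. \<exists>z. poly (F x) z = 0 \<and> z \<in> ball r e"
    proof
      fix r assume "r \<in> R"
      with D(2)[OF this x(1)] d_le[OF this] x(2)
      show "\<exists>z. poly (F x) z = 0 \<and> z \<in> ball r e" by (auto simp: dist_commute)
    qed
    then obtain g where g: "\<And>r. r \<in> R \<Longrightarrow> poly (F x) (g r) = 0" "\<And>r. r \<in> R \<Longrightarrow> g r \<in> ball r e"
      by metis
    have "inj_on g R"
      using disj g(2) by (intro inj_onI) (metis IntI empty_iff)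
    then have "card (g ` R) = card {z. poly (F x) z = 0}"
      using simple[OF assms] simple[OF x(1)] by (simp add: card_image R_def)
    moreover have "g ` R \<subseteq> {z. poly (F x) z = 0}" using g by auto
    ultimately have gR: "g ` R = {z. poly (F x) z = 0}"
      using finite_roots[OF x(1)] by (intro card_subset_eq) auto
    have uniq: "z = g r" if "r \<in> R" "poly (F x) z = 0" "z \<in> ball r e" for r z
    proof -
      from that(2) gR obtain r' where r': "r' \<in> R" "z = g r'" by auto
      then have "z \<in> ball r' e" using g by auto
      then have "r' = r" using disj that r'(1) by blast
      then show ?thesis using r' by simp
    qed
    show ?thesis
    proof (intro conjI ballI allI impI)
      fix r assume "r \<in> R"
      then show "\<exists>!z. poly (F x) z = 0 \<and> z \<in> ball r e" using g uniq by (intro ex1I[of _ "g r"]) auto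
    next
      fix z assume "poly (F x) z = 0"
      then have "z \<in> g ` R" using gR by simp
      then show "\<exists>r\<in>R. z \<in> ball r e" using g(2) by blast
    qed
  qed
  show ?thesis
  proof (rule that[OF \<open>e > 0\<close> \<open>d > 0\<close>])
    show "ball r e \<inter> ball r' e = {}" if "poly (F x0) r = 0" "poly (F x0) r' = 0" "r \<noteq> r'" for r r'
      using that by (intro disj) (auto simp: R_def)
    show "\<exists>!z. poly (F x) z = 0 \<and> z \<in> ball r e" if "x \<in> S" "dist x x0 < d" "poly (F x0) r = 0" for x r
      using conjunct1[OF main[OF that(1,2)]] that(3) unfolding R_def by blast
    show "\<exists>r. poly (F x0) r = 0 \<and> z \<in> ball r e" if "x \<in> S" "dist x x0 < d" "poly (F x) z = 0" for x z
      using conjunct2[OF main[OF that(1,2)]] that(3) unfolding R_def by blast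
  qed
qed

text \<open>Near \<open>x0\<close> the sheets are cut out by the isolating discs, and the unique
  root in a disc gives the inverse of the projection.\<close>

lemma covering: "covering_space total fst S"
proof (rule covering_spaceI)
  show "continuous_on total fst" by (intro continuous_intros)
  show "fst ` total = S"
  proof -
    have "\<exists>z. poly (F x) z = 0" if "x \<in> S" for x
    proof (rule ccontr)
      assume "\<not> (\<exists>z. poly (F x) z = 0)"
      then have "{z. poly (F x) z = 0} = {}" by blast
      then show False using simple[OF that] n_pos by simp
    qed
    then show ?thesis unfolding total_def by (auto simp: image_iff)
  qed
next
  fix x0 assume x0: "x0 \<in> S"
  obtain e d where ed: "e > 0" "d > 0"
    "\<And>r r'. poly (F x0) r = 0 \<Longrightarrow> poly (F x0) r' = 0 \<Longrightarrow> r \<noteq> r' \<Longrightarrow> ball r e \<inter> ball r' e = {}"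
    "\<And>x r. x \<in> S \<Longrightarrow> dist x x0 < d \<Longrightarrow> poly (F x0) r = 0 \<Longrightarrow> \<exists>!z. poly (F x) z = 0 \<and> z \<in> ball r e"
    "\<And>x z. x \<in> S \<Longrightarrow> dist x x0 < d \<Longrightarrow> poly (F x) z = 0 \<Longrightarrow> \<exists>r. poly (F x0) r = 0 \<and> z \<in> ball r e"
    using root_isolation[OF x0] by blast
  define T where "T = S \<inter> ball x0 d"
  define sheet where "sheet r = total \<inter> (ball x0 d \<times> ball r e)" for r
  have T: "x \<in> T \<longleftrightarrow> x \<in> S \<and> dist x x0 < d" for x by (auto simp: T_def dist_commute)
  have hom: "\<exists>q. homeomorphism (sheet r) T fst q" if r: "poly (F x0) r = 0" for r
  proof -
    define \<rho> where "\<rho> x = (THE z. poly (F x) z = 0 \<and> z \<in> ball r e)" for x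
    have \<rho>: "poly (F x) (\<rho> x) = 0" "\<rho> x \<in> ball r e" if "x \<in> T" for x
      using theI'[OF ed(4)[OF _ _ r, of x]] that by (auto simp: T \<rho>_def)
    have \<rho>_eq: "z = \<rho> x" if "x \<in> T" "poly (F x) z = 0" "z \<in> ball r e" for x z
      using ed(4)[OF _ _ r, of x] \<rho>[OF that(1)] that by (auto simp: T)
    have "continuous_on T \<rho>"
      unfolding continuous_on_iff
    proof (intro ballI allI impI)
      fix x1 and \<epsilon> :: real assume x1: "x1 \<in> T" "\<epsilon> > 0"
      \<comment> \<open>A root this close to \<open>\<rho> x1\<close> still lies in the disc around
        \<open>r\<close>, so by uniqueness there it is the value of \<open>\<rho>\<close>.\<close>
      define \<delta> where "\<delta> = min \<epsilon> (e - dist r (\<rho> x1))"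
      have "\<delta> > 0" using \<rho>(2)[OF x1(1)] x1(2) by (auto simp: \<delta>_def)
      obtain d' where d': "d' > 0" "\<And>x. x \<in> S \<Longrightarrow> dist x x1 < d' \<Longrightarrow> \<exists>z. poly (F x) z = 0 \<and> dist z (\<rho> x1) < \<delta>"
        using root_persists[of x1 "\<rho> x1" \<delta>] x1 \<rho>(1)[OF x1(1)] \<open>\<delta> > 0\<close> T by blast
      have "dist (\<rho> x) (\<rho> x1) < \<epsilon>" if x: "x \<in> T" "dist x x1 < d'" for x
      proof -
        obtain z where z: "poly (F x) z = 0" "dist z (\<rho> x1) < \<delta>" using d'(2)[of x] x T by blast
        have "dist r z \<le> dist r (\<rho> x1) + dist z (\<rho> x1)" by (metis dist_commute dist_triangle)
        then have "z \<in> ball r e" using z(2) by (auto simp: \<delta>_def)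
        then have "z = \<rho> x" using \<rho>_eq x z by blast
        then show ?thesis using z(2) by (auto simp: \<delta>_def)
      qed
      then show "\<exists>d>0. \<forall>x'\<in>T. dist x' x1 < d \<longrightarrow> dist (\<rho> x') (\<rho> x1) < \<epsilon>" using d'(1) by blast
    qed
    then have "homeomorphism (sheet r) T fst (\<lambda>x. (x, \<rho> x))"
    proof (intro homeomorphismI)
      show "(\<lambda>x. (x, \<rho> x)) ` T \<subseteq> sheet r"
        using \<rho> by (auto simp: sheet_def total_def T dist_commute)
      show "(fst a, \<rho> (fst a)) = a" if "a \<in> sheet r" for a
        using that \<rho>_eq[of "fst a" "snd a"] by (auto simp: sheet_def total_def T dist_commute)
    qed (auto simp: sheet_def total_def T dist_commute intro!: continuous_intros)
    then show ?thesis by blast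
  qed
  show "\<exists>T. x0 \<in> T \<and> openin (top_of_set S) T \<and>
     (\<exists>v. \<Union>v = total \<inter> fst -` T \<and> (\<forall>u\<in>v. openin (top_of_set total) u) \<and>
        pairwise disjnt v \<and> (\<forall>u\<in>v. \<exists>q. homeomorphism u T fst q))"
  proof (intro exI[of _ T] conjI exI[of _ "sheet ` {r. poly (F x0) r = 0}"])
    show "x0 \<in> T" using x0 ed by (simp add: T)
    show "openin (top_of_set S) T" by (auto simp: T_def)
    show "\<Union> (sheet ` {r. poly (F x0) r = 0}) = total \<inter> fst -` T"
      using ed(5) by (fastforce simp: sheet_def T total_def dist_commute)
    show "\<forall>u\<in>sheet ` {r. poly (F x0) r = 0}. openin (top_of_set total) u"
      unfolding sheet_def by (auto intro!: openin_open_Int open_Times)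
    show "pairwise disjnt (sheet ` {r. poly (F x0) r = 0})"
      using ed(3) by (fastforce simp: pairwise_def disjnt_def sheet_def)
    show "\<forall>u\<in>sheet ` {r. poly (F x0) r = 0}. \<exists>q. homeomorphism u T fst q"
      using hom by auto
  qed
qed

text \<open>Root functions are lifts of the identity of \<open>S\<close> through the covering, and
  lifts over a connected base are determined by one value.\<close>

lemma root_function_unique:
  assumes "connected S" "a \<in> S" "x \<in> S" "g a = h a"
    and "continuous_on S g" "\<And>x. x \<in> S \<Longrightarrow> poly (F x) (g x) = 0"
    and "continuous_on S h" "\<And>x. x \<in> S \<Longrightarrow> poly (F x) (h x) = 0"
  shows "g x = h x"
proof -
  have "(x, g x) = (x, h x)"
    by (rule covering_space_lift_unique[OF covering, of "\<lambda>x. (x, g x)" a "\<lambda>x. (x, h x)" S "\<lambda>x. x"])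
      (use assms in \<open>auto simp: total_def intro!: continuous_intros\<close>)
  then show ?thesis by simp
qed

text \<open>A convex base is simply connected and locally path connected, so its identity map lifts
  through the covering from each root over \<open>x0\<close>.\<close>

lemma root_functions:
  assumes "convex S" "x0 \<in> S"
  obtains \<rho> where "\<And>r. poly (F x0) r = 0 \<Longrightarrow> continuous_on S (\<rho> r)"
    "\<And>r. poly (F x0) r = 0 \<Longrightarrow> \<rho> r x0 = r"
    "\<And>x. x \<in> S \<Longrightarrow> bij_betw (\<lambda>r. \<rho> r x) {r. poly (F x0) r = 0} {z. poly (F x) z = 0}"
proof -
  have "\<exists>g. continuous_on S g \<and> g x0 = r \<and> (\<forall>x\<in>S. poly (F x) (g x) = 0)" if r: "poly (F x0) r = 0" for r
  proof -
    obtain g where g: "continuous_on S g" "g \<in> S \<rightarrow> total" "g x0 = (x0, r)" "\<And>y. y \<in> S \<Longrightarrow> fst (g y) = y"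
    proof (rule covering_space_lift_strong[OF covering, of "(x0, r)" x0 S "\<lambda>x. x"])
      show "(x0, r) \<in> total" using assms r by (simp add: total_def)
      show "simply_connected S" by (rule convex_imp_simply_connected[OF assms(1)])
      show "locally path_connected S" by (rule convex_imp_locally_path_connected[OF assms(1)])
    qed (use assms in auto)
    have "poly (F x) (snd (g x)) = 0" if "x \<in> S" for x
      using g(2,4) that by (auto simp: total_def Pi_iff split_beta)
    moreover have "continuous_on S (\<lambda>x. snd (g x))" using g(1) by (intro continuous_intros)
    ultimately show ?thesis using g(3) by (intro exI[of _ "\<lambda>x. snd (g x)"]) auto
  qed
  then have "\<forall>r. \<exists>g. poly (F x0) r = 0 \<longrightarrow>
      continuous_on S g \<and> g x0 = r \<and> (\<forall>x\<in>S. poly (F x) (g x) = 0)" by blast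
  from choice[OF this] obtain \<rho> where \<rho>: "\<And>r. poly (F x0) r = 0 \<Longrightarrow> continuous_on S (\<rho> r)"
    "\<And>r. poly (F x0) r = 0 \<Longrightarrow> \<rho> r x0 = r" 
    "\<And>r x. poly (F x0) r = 0 \<Longrightarrow> x \<in> S \<Longrightarrow> poly (F x) (\<rho> r x) = 0" by blast
  have "bij_betw (\<lambda>r. \<rho> r x) {r. poly (F x0) r = 0} {z. poly (F x) z = 0}" if "x \<in> S" for x
  proof -
    \<comment> \<open>Root functions that meet at \<open>x\<close> agree everywhere, in particular
      at \<open>x0\<close>, where their values are \<open>r\<close> and \<open>r'\<close>.\<close>
    have inj: "inj_on (\<lambda>r. \<rho> r x) {r. poly (F x0) r = 0}"
    proof (rule inj_onI)
      fix r r' assume r: "r \<in> {r. poly (F x0) r = 0}" "r' \<in> {r. poly (F x0) r = 0}" "\<rho> r x = \<rho> r' x"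
      then have "\<rho> r x0 = \<rho> r' x0"
        using assms that \<rho>(1,3)
        by (intro root_function_unique[of x x0 "\<rho> r" "\<rho> r'"]) (auto intro: convex_connected)
      then show "r = r'" using \<rho>(2) r by auto
    qed
    moreover have "(\<lambda>r. \<rho> r x) ` {r. poly (F x0) r = 0} = {z. poly (F x) z = 0}"
    proof (rule card_subset_eq)
      show "card ((\<lambda>r. \<rho> r x) ` {r. poly (F x0) r = 0}) = card {z. poly (F x) z = 0}"
        using card_image[OF inj] simple[OF assms(2)] simple[OF that] by simp
    qed (use \<rho>(3)[OF _ that] finite_roots[OF that] in auto)
    ultimately show ?thesis by (simp add: bij_betw_def)
  qed
  with \<rho>(1,2) show ?thesis by (rule that)
qed

end

section \<open>Ambient isotopies following moving points\<close>

text \<open>Each of the finitely many pairwise distances is continuous and positive on a compact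
  interval, so it attains a positive minimum.\<close>

lemma uniform_separation:
  fixes a :: "'i \<Rightarrow> real \<Rightarrow> complex"
  assumes "finite I" and cont: "\<And>i. i \<in> I \<Longrightarrow> continuous_on {0..1} (a i)"
    and dist: "\<And>i j t. i \<in> I \<Longrightarrow> j \<in> I \<Longrightarrow> i \<noteq> j \<Longrightarrow> t \<in> {0..1} \<Longrightarrow> a i t \<noteq> a j t"
  obtains r where "r > 0"
    "\<And>i j t. i \<in> I \<Longrightarrow> j \<in> I \<Longrightarrow> i \<noteq> j \<Longrightarrow> t \<in> {0..1} \<Longrightarrow> r \<le> dist (a i t) (a j t)"
proof -
  define A where "A = {p \<in> I \<times> I. fst p \<noteq> snd p}"
  have "finite A" unfolding A_def using assms(1) by auto
  have "\<exists>r>0. \<forall>t\<in>{0..1}. r \<le> dist (a (fst p) t) (a (snd p) t)" if "p \<in> A" for p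
  proof -
    have c: "continuous_on {0..1} (\<lambda>t. dist (a (fst p) t) (a (snd p) t))"
      using that cont by (intro continuous_intros) (auto simp: A_def)
    obtain t0 where t0: "t0 \<in> {0..1}"
      "\<forall>t\<in>{0..1}. dist (a (fst p) t0) (a (snd p) t0) \<le> dist (a (fst p) t) (a (snd p) t)"
      using continuous_attains_inf[OF compact_Icc _ c] by auto
    moreover have "dist (a (fst p) t0) (a (snd p) t0) > 0"
      using dist[of "fst p" "snd p" t0] that t0(1) by (auto simp: A_def)
    ultimately show ?thesis by blast
  qed
  then have "\<forall>p. \<exists>r. p \<in> A \<longrightarrow> r > 0 \<and> (\<forall>t\<in>{0..1}. r \<le> dist (a (fst p) t) (a (snd p) t))" by blast
  from choice[OF this] obtain \<rho> where \<rho>: "\<And>p. p \<in> A \<Longrightarrow> \<rho> p > 0"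
    "\<And>p t. p \<in> A \<Longrightarrow> t \<in> {0..1} \<Longrightarrow> \<rho> p \<le> dist (a (fst p) t) (a (snd p) t)" by blast
  define r where "r = Min (insert 1 (\<rho> ` A))"
  have "r > 0" using \<open>finite A\<close> \<rho>(1) by (auto simp: r_def)
  moreover have "r \<le> dist (a i t) (a j t)" if "i \<in> I" "j \<in> I" "i \<noteq> j" "t \<in> {0..1}" for i j t
  proof -
    have "(i, j) \<in> A" using that by (simp add: A_def)
    then have "r \<le> \<rho> (i, j)" using \<open>finite A\<close> by (auto simp: r_def)
    then show ?thesis using \<rho>(2)[OF \<open>(i, j) \<in> A\<close> that(4)] by simp
  qed
  ultimately show ?thesis by (rule that)
qed

text \<open>The map \<open>z \<mapsto> z + push I r c v z\<close> moves each \<open>c i\<close> to \<open>c i + v i\<close> if the \<open>c i\<close> are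
  \<open>r\<close>-separated, and is a homeomorphism if the total displacement is at most \<open>r / 2\<close>.\<close>

definition push :: "'i set \<Rightarrow> real \<Rightarrow> ('i \<Rightarrow> complex) \<Rightarrow> ('i \<Rightarrow> complex) \<Rightarrow> complex \<Rightarrow> complex" where
  "push I r c v z = (\<Sum>i\<in>I. max 0 (1 - norm (z - c i) / r) *\<^sub>R v i)"

text \<open>Each bump has Lipschitz constant \<open>1 / r\<close>, and the norms of the
  \<open>v i\<close> sum to at most \<open>r / 2\<close>.\<close>

lemma push_lipschitz:
  assumes "r > 0" "(\<Sum>i\<in>I. norm (v i)) \<le> r / 2"
  shows "norm (push I r c v z - push I r c v z') \<le> norm (z - z') / 2"
proof -
  have b: "\<bar>max 0 (1 - norm (z - c i) / r) - max 0 (1 - norm (z' - c i) / r)\<bar> \<le> norm (z - z') / r" for i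
  proof -
    have "\<bar>norm (z - c i) - norm (z' - c i)\<bar> \<le> norm (z - z')"
      using norm_triangle_ineq3[of "z - c i" "z' - c i"] by simp
    then have "\<bar>norm (z - c i) / r - norm (z' - c i) / r\<bar> \<le> norm (z - z') / r"
      using assms(1) by (simp add: diff_divide_distrib[symmetric] abs_divide divide_right_mono)
    moreover have "\<bar>max 0 (1 - A) - max 0 (1 - B)\<bar> \<le> D" if "\<bar>A - B\<bar> \<le> D" for A B D :: real
      using that by (auto simp: max_def abs_if split: if_splits)
    ultimately show ?thesis by blast
  qed
  have "norm (push I r c v z - push I r c v z') =
      norm (\<Sum>i\<in>I. (max 0 (1 - norm (z - c i) / r) - max 0 (1 - norm (z' - c i) / r)) *\<^sub>R v i)"
    by (simp add: push_def sum_subtractf scaleR_left_diff_distrib)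
  also have "\<dots> \<le> (\<Sum>i\<in>I. norm (z - z') / r * norm (v i))"
    by (rule sum_norm_le) (unfold norm_scaleR, intro mult_right_mono b norm_ge_zero)
  also have "\<dots> = norm (z - z') / r * (\<Sum>i\<in>I. norm (v i))" by (simp add: sum_distrib_left)
  also have "\<dots> \<le> norm (z - z') / r * (r / 2)"
    using assms by (intro mult_left_mono) auto
  also have "\<dots> = norm (z - z') / 2" using assms(1) by simp
  finally show ?thesis .
qed

lemma push_displacement:
  assumes "r > 0"
  shows "norm (push I r c v z - push I r c v' z) \<le> (\<Sum>i\<in>I. norm (v i - v' i))"
proof -
  have "push I r c v z - push I r c v' z = (\<Sum>i\<in>I. max 0 (1 - norm (z - c i) / r) *\<^sub>R (v i - v' i))"
    by (simp add: push_def sum_subtractf scaleR_diff_right)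
  also have "norm \<dots> \<le> (\<Sum>i\<in>I. norm (v i - v' i))"
  proof (rule sum_norm_le)
    fix i
    have "\<bar>max 0 (1 - norm (z - c i) / r)\<bar> \<le> 1" using assms by auto
    then show "norm (max 0 (1 - norm (z - c i) / r) *\<^sub>R (v i - v' i)) \<le> norm (v i - v' i)"
      by (simp add: mult_left_le_one_le)
  qed
  finally show ?thesis .
qed

lemma push_inverse_ex1:
  assumes "r > 0" "(\<Sum>i\<in>I. norm (v i)) \<le> r / 2"
  shows "\<exists>!z. z + push I r c v z = y"
proof -
  \<comment> \<open>Solving for \<open>z\<close> is a fixed point problem for the map sending
    \<open>z\<close> to \<open>y - push I r c v z\<close>, which contracts by 1/2 according to
    \<open>push_lipschitz\<close>.\<close>
  have "\<exists>!z. z \<in> UNIV \<and> y - push I r c v z = z"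
  proof (rule Banach_fix[of UNIV "1/2"])
    fix z z' show "dist (y - push I r c v z) (y - push I r c v z') \<le> 1 / 2 * dist z z'"
      using push_lipschitz[OF assms, of c z z'] by (simp add: dist_norm norm_minus_commute)
  qed (auto simp: complete_UNIV)
  moreover have "z + push I r c v z = y \<longleftrightarrow> y - push I r c v z = z" for z
    by (auto simp: algebra_simps)
  ultimately show ?thesis by simp
qed

text \<open>Here \<open>\<phi>\<close> is a compactly supported isotopy of the plane that drags the
  points \<open>a i\<close> along. The inverse \<open>\<psi>\<close> is recorded with its own joint
  continuity because base points are later pulled back through it.\<close>

definition moving_trivial :: "'i set \<Rightarrow> ('i \<Rightarrow> real \<Rightarrow> complex) \<Rightarrow> real \<Rightarrow> real \<Rightarrow> bool" where
  "moving_trivial I a s t \<longleftrightarrow> (\<exists>(\<phi> :: real \<Rightarrow> complex \<Rightarrow> complex) (\<psi> :: real \<Rightarrow> complex \<Rightarrow> complex) R.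
     continuous_on ({s..t} \<times> UNIV) (\<lambda>x. \<phi> (fst x) (snd x)) \<and>
     continuous_on ({s..t} \<times> UNIV) (\<lambda>x. \<psi> (fst x) (snd x)) \<and>
     (\<forall>\<tau>\<in>{s..t}. \<forall>z. \<phi> \<tau> (\<psi> \<tau> z) = z \<and> \<psi> \<tau> (\<phi> \<tau> z) = z) \<and>
     (\<forall>\<tau>\<in>{s..t}. \<forall>i\<in>I. \<phi> \<tau> (a i s) = a i \<tau>) \<and>
     (\<forall>z. \<phi> s z = z) \<and>
     (\<forall>\<tau>\<in>{s..t}. \<forall>z. norm z \<ge> R \<longrightarrow> \<phi> \<tau> z = z))"

text \<open>While the points have moved by at most \<open>r / 2\<close> in total, a single
  \<open>push\<close> from their positions at time \<open>s\<close> serves as the isotopy.\<close>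

lemma moving_trivial_short:
  fixes a :: "'i \<Rightarrow> real \<Rightarrow> complex"
  assumes "finite I" "r > 0" "s \<le> t"
    and cont: "\<And>i. i \<in> I \<Longrightarrow> continuous_on {s..t} (a i)"
    and sep: "\<And>i j. i \<in> I \<Longrightarrow> j \<in> I \<Longrightarrow> i \<noteq> j \<Longrightarrow> r \<le> dist (a i s) (a j s)"
    and short: "\<And>\<tau>. \<tau> \<in> {s..t} \<Longrightarrow> (\<Sum>i\<in>I. norm (a i \<tau> - a i s)) \<le> r / 2"
  shows "moving_trivial I a s t"
proof -
  define v where "v \<tau> i = a i \<tau> - a i s" for \<tau> i
  define g where "g \<tau> z = push I r (\<lambda>i. a i s) (v \<tau>) z" for \<tau> z
  define \<phi> where "\<phi> \<tau> z = z + g \<tau> z" for \<tau> z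
  define \<psi> where "\<psi> \<tau> y = (THE z. \<phi> \<tau> z = y)" for \<tau> y
  have ex1: "\<exists>!z. \<phi> \<tau> z = y" if "\<tau> \<in> {s..t}" for \<tau> y
    unfolding \<phi>_def g_def using assms(2) short[OF that] by (intro push_inverse_ex1) (auto simp: v_def)
  have \<phi>\<psi>: "\<phi> \<tau> (\<psi> \<tau> y) = y" if "\<tau> \<in> {s..t}" for \<tau> y
    unfolding \<psi>_def by (rule theI'[OF ex1[OF that]])
  have \<psi>\<phi>: "\<psi> \<tau> (\<phi> \<tau> z) = z" if "\<tau> \<in> {s..t}" for \<tau> z
    using ex1[OF that, of "\<phi> \<tau> z"] \<phi>\<psi>[OF that, of "\<phi> \<tau> z"] by blast
  have cont_fst: "continuous_on ({s..t} \<times> UNIV) (\<lambda>x :: real \<times> complex. a i (fst x))" if "i \<in> I" for i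
    by (rule continuous_on_compose2[OF cont[OF that]]) (auto intro!: continuous_intros)
  have cont\<phi>: "continuous_on ({s..t} \<times> UNIV) (\<lambda>x. \<phi> (fst x) (snd x))"
    unfolding \<phi>_def g_def push_def v_def using assms(2)
    by (intro continuous_intros cont_fst) auto
  \<comment> \<open>Half of the left-hand side reappears on the right through the contraction bound;
    absorbing it gives the factor 2. The estimate yields joint continuity of
    \<open>\<psi>\<close>.\<close>
  have est: "norm (\<psi> \<tau> y - \<psi> \<tau>' y') \<le> 2 * (norm (y - y') + (\<Sum>i\<in>I. norm (a i \<tau> - a i \<tau>')))"
    if "\<tau> \<in> {s..t}" "\<tau>' \<in> {s..t}" for \<tau> \<tau>' y y'
  proof -
    let ?z = "\<psi> \<tau> y" and ?z' = "\<psi> \<tau>' y'"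
    have z: "?z = y - g \<tau> ?z" and z': "?z' = y' - g \<tau>' ?z'"
      using \<phi>\<psi>[OF that(1), of y] \<phi>\<psi>[OF that(2), of y'] by (auto simp: \<phi>_def algebra_simps)
    have "?z - ?z' = (y - y') - (g \<tau> ?z - g \<tau> ?z') - (g \<tau> ?z' - g \<tau>' ?z')"
      by (subst z, subst z') (simp add: algebra_simps)
    moreover have "norm (A - B - C) \<le> norm A + norm B + norm C" for A B C :: complex
      using norm_triangle_ineq4[of "A - B" C] norm_triangle_ineq4[of A B] by linarith
    ultimately have "norm (?z - ?z') \<le> norm (y - y') + norm (g \<tau> ?z - g \<tau> ?z') + norm (g \<tau> ?z' - g \<tau>' ?z')"
      by (simp only:)
    moreover have "norm (g \<tau> ?z - g \<tau> ?z') \<le> norm (?z - ?z') / 2"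
      unfolding g_def using assms(2) short[OF that(1)] by (intro push_lipschitz) (auto simp: v_def)
    moreover have "norm (g \<tau> ?z' - g \<tau>' ?z') \<le> (\<Sum>i\<in>I. norm (a i \<tau> - a i \<tau>'))"
      unfolding g_def using push_displacement[OF assms(2), of I "\<lambda>i. a i s" "v \<tau>" ?z' "v \<tau>'"]
      by (simp add: v_def)
    ultimately show ?thesis by simp
  qed
  have cont\<psi>: "continuous_on ({s..t} \<times> UNIV) (\<lambda>x. \<psi> (fst x) (snd x))"
    unfolding continuous_on_def
  proof
    fix x0 :: "real \<times> complex" assume x0: "x0 \<in> {s..t} \<times> UNIV"
    define k where "k x = 2 * (norm (snd x - snd x0) + (\<Sum>i\<in>I. norm (a i (fst x) - a i (fst x0))))" for x
    have "continuous_on ({s..t} \<times> UNIV) k"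
      unfolding k_def by (intro continuous_intros cont_fst)
    then have "(k \<longlongrightarrow> k x0) (at x0 within {s..t} \<times> UNIV)" using x0 unfolding continuous_on_def by blast
    moreover have "k x0 = 0" by (simp add: k_def)
    ultimately have k0: "(k \<longlongrightarrow> 0) (at x0 within {s..t} \<times> UNIV)" by simp
    show "((\<lambda>x. \<psi> (fst x) (snd x)) \<longlongrightarrow> \<psi> (fst x0) (snd x0)) (at x0 within {s..t} \<times> UNIV)"
    proof (rule metric_tendsto_imp_tendsto[OF k0])
      have "dist (\<psi> (fst x) (snd x)) (\<psi> (fst x0) (snd x0)) \<le> dist (k x) 0" if "x \<in> {s..t} \<times> UNIV" for x
        using est[of "fst x" "fst x0" "snd x" "snd x0"] that x0 by (auto simp: k_def dist_norm mem_Times_iff)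
      then show "\<forall>\<^sub>F x in at x0 within {s..t} \<times> UNIV. dist (\<psi> (fst x) (snd x)) (\<psi> (fst x0) (snd x0)) \<le> dist (k x) 0"
        by (auto simp: eventually_at_filter)
    qed
  qed
  \<comment> \<open>At \<open>a i s\<close> the bump of \<open>i\<close> equals 1, and the others
    vanish since their centres are at least \<open>r\<close> away.\<close>
  have marked: "\<phi> \<tau> (a i s) = a i \<tau>" if "i \<in> I" for \<tau> i
  proof -
    have "g \<tau> (a i s) = (\<Sum>j\<in>I. if j = i then v \<tau> i else 0)"
      unfolding g_def push_def
    proof (rule sum.cong)
      fix j assume "j \<in> I"
      then show "max 0 (1 - norm (a i s - a j s) / r) *\<^sub>R v \<tau> j = (if j = i then v \<tau> i else 0)"
        using sep[of i j] that assms(2) by (auto simp: dist_norm max_def field_simps)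
    qed simp
    also have "\<dots> = v \<tau> i" using assms(1) that by simp
    finally show ?thesis by (simp add: \<phi>_def v_def)
  qed
  have far: "\<phi> \<tau> z = z" if "norm z \<ge> r + (\<Sum>i\<in>I. norm (a i s))" for \<tau> z
  proof -
    have "max 0 (1 - norm (z - a i s) / r) = 0" if "i \<in> I" for i
    proof -
      have "norm (a i s) \<le> (\<Sum>i\<in>I. norm (a i s))" using that assms(1) by (intro member_le_sum) auto
      then have "r \<le> norm (z - a i s)"
        using \<open>norm z \<ge> _\<close> norm_triangle_ineq2[of z "a i s"] by linarith
      then show ?thesis using assms(2) by (simp add: max_def)
    qed
    then show ?thesis by (simp add: \<phi>_def g_def push_def)
  qed
  have start: "\<phi> s z = z" for z by (simp add: \<phi>_def g_def push_def v_def)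
  show ?thesis
    unfolding moving_trivial_def using cont\<phi> cont\<psi> \<phi>\<psi> \<psi>\<phi> marked far start
    by (intro exI[of _ \<phi>] exI[of _ \<psi>] exI[of _ "r + (\<Sum>i\<in>I. norm (a i s))"]) blast
qed

lemma continuous_on_glue_strips:
  fixes f g :: "real \<Rightarrow> complex \<Rightarrow> complex"
  assumes "continuous_on ({a..b} \<times> UNIV) (\<lambda>x. f (fst x) (snd x))"
    and "continuous_on ({b..c} \<times> UNIV) (\<lambda>x. g (fst x) (snd x))"
    and "\<And>z. f b z = g b z" "a \<le> b" "b \<le> c"
  shows "continuous_on ({a..c} \<times> UNIV) (\<lambda>x. (if fst x \<le> b then f (fst x) else g (fst x)) (snd x))"
proof -
  have "continuous_on ({a..b} \<times> UNIV \<union> {b..c} \<times> UNIV)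
      (\<lambda>x. if fst x \<le> b then f (fst x) (snd x) else g (fst x) (snd x))"
    by (rule continuous_on_cases[OF _ _ assms(1,2)]) (use assms(3) in \<open>auto intro!: closed_Times simp: antisym_conv\<close>)
  moreover have "{a..b} \<times> UNIV \<union> {b..c} \<times> UNIV = {a..c} \<times> (UNIV :: complex set)" using assms(4,5) by auto
  ultimately show ?thesis by (simp add: if_distribR)
qed

text \<open>After time \<open>t\<close> the second isotopy is applied on top of the final map of the
  first; the inverses compose in the opposite order.\<close>

lemma moving_trivial_trans:
  assumes "moving_trivial I a s t" "moving_trivial I a t u" "s \<le> t" "t \<le> u"
  shows "moving_trivial I a s u"
proof -
  obtain \<phi> \<psi> :: "real \<Rightarrow> complex \<Rightarrow> complex" and R where 1:
     "continuous_on ({s..t} \<times> UNIV) (\<lambda>x. \<phi> (fst x) (snd x))"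
     "continuous_on ({s..t} \<times> UNIV) (\<lambda>x. \<psi> (fst x) (snd x))"
     "\<forall>\<tau>\<in>{s..t}. \<forall>z. \<phi> \<tau> (\<psi> \<tau> z) = z \<and> \<psi> \<tau> (\<phi> \<tau> z) = z"
     "\<forall>\<tau>\<in>{s..t}. \<forall>i\<in>I. \<phi> \<tau> (a i s) = a i \<tau>"
     "\<forall>z. \<phi> s z = z"
     "\<forall>\<tau>\<in>{s..t}. \<forall>z. norm z \<ge> R \<longrightarrow> \<phi> \<tau> z = z"
    using assms(1) unfolding moving_trivial_def by blast
  obtain \<phi>' \<psi>' :: "real \<Rightarrow> complex \<Rightarrow> complex" and R' where 2:
     "continuous_on ({t..u} \<times> UNIV) (\<lambda>x. \<phi>' (fst x) (snd x))"
     "continuous_on ({t..u} \<times> UNIV) (\<lambda>x. \<psi>' (fst x) (snd x))"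
     "\<forall>\<tau>\<in>{t..u}. \<forall>z. \<phi>' \<tau> (\<psi>' \<tau> z) = z \<and> \<psi>' \<tau> (\<phi>' \<tau> z) = z"
     "\<forall>\<tau>\<in>{t..u}. \<forall>i\<in>I. \<phi>' \<tau> (a i t) = a i \<tau>"
     "\<forall>z. \<phi>' t z = z"
     "\<forall>\<tau>\<in>{t..u}. \<forall>z. norm z \<ge> R' \<longrightarrow> \<phi>' \<tau> z = z"
    using assms(2) unfolding moving_trivial_def by blast
  have \<psi>'t: "\<psi>' t z = z" for z using 2(3,5) assms(4) by (metis atLeastAtMost_iff order_refl)
  define \<Phi> where "\<Phi> \<tau> = (if \<tau> \<le> t then \<phi> \<tau> else (\<lambda>z. \<phi>' \<tau> (\<phi> t z)))" for \<tau>
  define \<Psi> where "\<Psi> \<tau> = (if \<tau> \<le> t then \<psi> \<tau> else (\<lambda>z. \<psi> t (\<psi>' \<tau> z)))" for \<tau>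
  have c1: "continuous_on ({t..u} \<times> UNIV) (\<lambda>x. \<phi>' (fst x) (\<phi> t (snd x)))"
    using assms(3)
    by (intro continuous_on_compose2_prod[OF 2(1)] continuous_on_compose2_prod[OF 1(1)] continuous_intros) auto
  have c2: "continuous_on ({t..u} \<times> UNIV) (\<lambda>x. \<psi> t (\<psi>' (fst x) (snd x)))"
    using assms(3)
    by (intro continuous_on_compose2_prod[OF 1(2)] 2(2) continuous_intros) auto
  have "continuous_on ({s..u} \<times> UNIV) (\<lambda>x. \<Phi> (fst x) (snd x))"
    unfolding \<Phi>_def using continuous_on_glue_strips[OF 1(1) c1 _ assms(3,4)] 2(5) by simp
  moreover have "continuous_on ({s..u} \<times> UNIV) (\<lambda>x. \<Psi> (fst x) (snd x))"
    unfolding \<Psi>_def using continuous_on_glue_strips[OF 1(2) c2 _ assms(3,4)] \<psi>'t by simp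
  moreover have "\<forall>\<tau>\<in>{s..u}. \<forall>z. \<Phi> \<tau> (\<Psi> \<tau> z) = z \<and> \<Psi> \<tau> (\<Phi> \<tau> z) = z"
    using 1(3) 2(3) assms(3) by (auto simp: \<Phi>_def \<Psi>_def)
  moreover have "\<forall>\<tau>\<in>{s..u}. \<forall>i\<in>I. \<Phi> \<tau> (a i s) = a i \<tau>"
    using 1(4) 2(4) assms(3) by (auto simp: \<Phi>_def)
  moreover have "\<forall>z. \<Phi> s z = z" using 1(5) assms(3) by (auto simp: \<Phi>_def)
  moreover have "\<forall>\<tau>\<in>{s..u}. \<forall>z. norm z \<ge> max R R' \<longrightarrow> \<Phi> \<tau> z = z"
    using 1(6) 2(6) assms(3) by (auto simp: \<Phi>_def)
  ultimately show ?thesis unfolding moving_trivial_def by blast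
qed

lemma moving_trivial_unit:
  fixes a :: "'i \<Rightarrow> real \<Rightarrow> complex"
  assumes "finite I" and cont: "\<And>i. i \<in> I \<Longrightarrow> continuous_on {0..1} (a i)"
    and dist: "\<And>i j t. i \<in> I \<Longrightarrow> j \<in> I \<Longrightarrow> i \<noteq> j \<Longrightarrow> t \<in> {0..1} \<Longrightarrow> a i t \<noteq> a j t"
  shows "moving_trivial I a 0 1"
proof -
  obtain r where r: "r > 0"
    "\<And>i j t. i \<in> I \<Longrightarrow> j \<in> I \<Longrightarrow> i \<noteq> j \<Longrightarrow> t \<in> {0..1} \<Longrightarrow> r \<le> dist (a i t) (a j t)"
    using uniform_separation[of I a, OF assms] by blast
  \<comment> \<open>The total displacement is uniformly small over short times; induction over the
    finite index set splits \<open>e\<close> into halves.\<close>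
  have "\<exists>d>0. \<forall>s\<in>{0..1}. \<forall>t\<in>{0..1}. \<bar>t - s\<bar> < d \<longrightarrow> (\<Sum>i\<in>J. norm (a i t - a i s)) < e"
    if "J \<subseteq> I" "e > 0" for J e
    using finite_subset[OF that(1) assms(1)] that
  proof (induction J arbitrary: e rule: finite_induct)
    case empty
    then show ?case by (auto intro: exI[of _ 1])
  next
    case (insert j J)
    obtain d1 where d1: "d1 > 0"
      "\<forall>s\<in>{0..1}. \<forall>t\<in>{0..1}. \<bar>t - s\<bar> < d1 \<longrightarrow> (\<Sum>i\<in>J. norm (a i t - a i s)) < e / 2"
      using insert.IH[of "e / 2"] insert.prems by auto
    have "uniformly_continuous_on {0..1} (a j)"
      using insert.prems by (intro compact_uniformly_continuous cont) auto
    then obtain d2 where d2: "d2 > 0"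
      "\<forall>s\<in>{0..1}. \<forall>t\<in>{0..1}. dist t s < d2 \<longrightarrow> dist (a j t) (a j s) < e / 2"
      unfolding uniformly_continuous_on_def using insert.prems by (meson half_gt_zero)
    have "(\<Sum>i\<in>insert j J. norm (a i t - a i s)) < e" if "s \<in> {0..1}" "t \<in> {0..1}" "\<bar>t - s\<bar> < min d1 d2" for s t
    proof -
      have "norm (a j t - a j s) < e / 2" using d2 that by (auto simp: dist_norm)
      moreover have "(\<Sum>i\<in>J. norm (a i t - a i s)) < e / 2" using d1 that by auto
      ultimately show ?thesis using insert.hyps by simp
    qed
    then show ?case using d1(1) d2(1) by (intro exI[of _ "min d1 d2"]) auto
  qed
  from this[OF order_refl, of "r / 2"] r(1) obtain d where d: "d > 0"
    "\<forall>s\<in>{0..1}. \<forall>t\<in>{0..1}. \<bar>t - s\<bar> < d \<longrightarrow> (\<Sum>i\<in>I. norm (a i t - a i s)) < r / 2" by auto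
  define P where "P s t \<longleftrightarrow> (0 \<le> s \<and> s \<le> t \<and> t \<le> 1 \<longrightarrow> moving_trivial I a s t)" for s t
  have "(0::real) \<le> 1" by simp
  \<comment> \<open>Bisection: triviality passes to the union of adjacent intervals, and it holds on
    all intervals shorter than \<open>d\<close>.\<close>
  then have "P 0 1"
  proof (induct rule: Bolzano)
    case (trans s t u)
    then show ?case unfolding P_def using moving_trivial_trans[of I a s t u] by auto
  next
    case (local x)
    have "P s t" if "s \<le> x" "x \<le> t" "t - s < d" for s t
      unfolding P_def
    proof
      assume st: "0 \<le> s \<and> s \<le> t \<and> t \<le> 1"
      show "moving_trivial I a s t"
      proof (rule moving_trivial_short[OF assms(1) r(1)])
        show "(\<Sum>i\<in>I. norm (a i \<tau> - a i s)) \<le> r / 2" if "\<tau> \<in> {s..t}" for \<tau>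
          using d(2)[rule_format, of s \<tau>] that st \<open>t - s < d\<close> by auto
      qed (use st r(2) in \<open>auto intro: continuous_on_subset[OF cont]\<close>)
    qed
    then show ?case using d(1) by blast
  qed
  then show ?thesis by (simp add: P_def)
qed

section \<open>Critical values of families\<close>

text \<open>A common zero \<open>a\<close> of \<open>p\<close> and its derivative gives
  \<open>p = [:- a, 1:] * q\<close> with \<open>q\<close> vanishing at \<open>a\<close>; then all
  roots of \<open>p\<close> are roots of \<open>q\<close>, whose degree is smaller. Without such a
  zero, \<open>p\<close> is a constant times a product of distinct linear factors.\<close>

lemma card_roots_eq_degree_iff:
  fixes p :: "complex poly"
  assumes "p \<noteq> 0"
  shows "card {z. poly p z = 0} = degree p \<longleftrightarrow> (\<forall>a. \<not> (poly p a = 0 \<and> poly (pderiv p) a = 0))"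
proof
  assume card: "card {z. poly p z = 0} = degree p"
  show "\<forall>a. \<not> (poly p a = 0 \<and> poly (pderiv p) a = 0)"
  proof (intro allI notI)
    fix a assume a: "poly p a = 0 \<and> poly (pderiv p) a = 0"
    then obtain q where q: "p = [:- a, 1:] * q" by (auto simp: poly_eq_0_iff_dvd elim: dvdE)
    then have "q \<noteq> 0" using assms by auto
    have "poly q a = 0" using a unfolding q pderiv_mult by (simp add: pderiv_pCons)
    then have "{z. poly p z = 0} \<subseteq> {z. poly q z = 0}" by (auto simp: q)
    then have "card {z. poly p z = 0} \<le> degree q"
      by (rule order_trans[OF card_mono[OF poly_roots_finite[OF \<open>q \<noteq> 0\<close>]] card_poly_roots_bound[OF \<open>q \<noteq> 0\<close>]])
    moreover have "degree p = Suc (degree q)" unfolding q using \<open>q \<noteq> 0\<close> by (subst degree_mult_eq) auto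
    ultimately show False using card by simp
  qed
next
  assume "\<forall>a. \<not> (poly p a = 0 \<and> poly (pderiv p) a = 0)"
  then have "rsquarefree p" by (simp add: rsquarefree_roots)
  from complex_poly_decompose_rsquarefree[OF this]
  have "degree p = degree (\<Prod>z|poly p z = 0. [:-z, 1:])"
    using assms by (metis degree_smult_eq leading_coeff_0_iff)
  also have "\<dots> = card {z. poly p z = 0}" by (subst degree_prod_eq_sum_degree) auto
  finally show "card {z. poly p z = 0} = degree p" ..
qed

lemma pderiv_diff_const: "pderiv (f - [:w:]) = pderiv f" for f :: "complex poly"
  by (simp add: pderiv_diff pderiv_pCons)

lemma degree_diff_const: "degree f > 0 \<Longrightarrow> degree (f - [:w:]) = degree f"
  for f :: "complex poly"
  unfolding diff_conv_add_uminus by (intro degree_add_eq_left) simp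

text \<open>The common zeros of \<open>f - [:w:]\<close> and its derivative are the critical points
  over \<open>w\<close>.\<close>

lemma card_roots_diff_const_iff:
  assumes "degree f > 0"
  shows "card {z. poly (f - [:w:]) z = 0} = degree f \<longleftrightarrow> w \<notin> critical_values f"
proof -
  have "f - [:w:] \<noteq> 0" using degree_diff_const[OF assms, of w] assms by auto
  from card_roots_eq_degree_iff[OF this] show ?thesis
    by (auto simp: degree_diff_const[OF assms] pderiv_diff_const critical_values_def critical_points_def)
qed

text \<open>At most \<open>m\<close> critical points are mapped onto \<open>m\<close> critical
  values, which forces a bijection.\<close>

lemma critical_points_simple:
  assumes deg: "degree f = Suc m" and good: "card (critical_values f) = m"
  shows "card (critical_points f) = m" "inj_on (poly f) (critical_points f)"
proof -
  have fin: "finite (critical_points f)" using deg by (intro finite_critical_points) simp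
  have "m \<le> card (critical_points f)"
    using card_image_le[OF fin, of "poly f"] good by (simp add: critical_values_def)
  then show "card (critical_points f) = m" using card_critical_points_le[of f] deg by simp
  then show "inj_on (poly f) (critical_points f)"
    using good fin by (intro eq_card_imp_inj_on) (auto simp: critical_values_def)
qed

text \<open>A Cauchy bound for the roots, uniform because the coefficients are bounded on the
  compact set \<open>S\<close>.\<close>

lemma roots_bounded:
  assumes "compact S" "coeffs_continuous_on S F" "c \<noteq> 0"
    and deg: "\<And>x. x \<in> S \<Longrightarrow> degree (F x) = n" and lead: "\<And>x. x \<in> S \<Longrightarrow> lead_coeff (F x) = c"
  obtains R where "\<And>x z. x \<in> S \<Longrightarrow> poly (F x) z = 0 \<Longrightarrow> norm z \<le> R"
proof -
  have "\<forall>i. \<exists>A. \<forall>x\<in>S. norm (coeff (F x) i) \<le> A"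
  proof
    fix i
    have "compact ((\<lambda>x. coeff (F x) i) ` S)"
      using assms(1,2) by (intro compact_continuous_image) (auto simp: coeffs_continuous_on_def)
    then have "bounded ((\<lambda>x. coeff (F x) i) ` S)" by (rule compact_imp_bounded)
    then show "\<exists>A. \<forall>x\<in>S. norm (coeff (F x) i) \<le> A" by (auto simp: bounded_iff)
  qed
  from choice[OF this] obtain A where A: "\<And>i x. x \<in> S \<Longrightarrow> norm (coeff (F x) i) \<le> A i" by blast
  define R where "R = max 1 ((\<Sum>i<n. A i) / norm c)"
  have "norm z \<le> R" if x: "x \<in> S" and z: "poly (F x) z = 0" for x z
  proof (cases "norm z \<le> 1")
    case True
    then show ?thesis by (simp add: R_def)
  next
    case False
    have "n \<noteq> 0"
    proof
      assume "n = 0"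
      then obtain k where "F x = [:k:]" using deg[OF x] by (auto elim: degree_eq_zeroE)
      then show False using z lead[OF x] assms(3) by simp
    qed
    then obtain m where m: "n = Suc m" by (cases n) auto
    have "0 = (\<Sum>i\<le>n. coeff (F x) i * z ^ i)" using z deg[OF x] by (simp add: poly_altdef)
    also have "\<dots> = (\<Sum>i<n. coeff (F x) i * z ^ i) + c * z ^ n"
      using lead[OF x] deg[OF x] by (simp add: lessThan_Suc_atMost[symmetric])
    finally have "c * z ^ n = - (\<Sum>i<n. coeff (F x) i * z ^ i)" by (simp add: eq_neg_iff_add_eq_0 add.commute)
    then have "norm c * norm z ^ n = norm (\<Sum>i<n. coeff (F x) i * z ^ i)"
      by (metis norm_minus_cancel norm_mult norm_power)
    also have "\<dots> \<le> (\<Sum>i<n. A i * norm z ^ m)"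
    proof (rule sum_norm_le)
      fix i assume "i \<in> {..<n}"
      then have "norm z ^ i \<le> norm z ^ m" using False m by (intro power_increasing) auto
      then show "norm (coeff (F x) i * z ^ i) \<le> A i * norm z ^ m"
        unfolding norm_mult norm_power using A[OF x, of i] by (intro mult_mono) (auto intro: order_trans[OF norm_ge_zero])
    qed
    also have "\<dots> = (\<Sum>i<n. A i) * norm z ^ m" by (simp add: sum_distrib_right)
    finally have "(norm c * norm z) * norm z ^ m \<le> (\<Sum>i<n. A i) * norm z ^ m" by (simp add: m mult_ac)
    moreover have "norm z ^ m > 0" using False by (intro zero_less_power) linarith
    ultimately have "norm c * norm z \<le> (\<Sum>i<n. A i)" by simp
    then have "norm z \<le> (\<Sum>i<n. A i) / norm c" using assms(3) by (simp add: field_simps)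
    then show ?thesis by (simp add: R_def)
  qed
  then show ?thesis using that by blast
qed

lemma lead_coeff_pderiv:
  "degree f = Suc m \<Longrightarrow> lead_coeff (pderiv f) = of_nat (Suc m) * lead_coeff f" for f :: "complex poly"
  by (simp add: coeff_pderiv degree_pderiv)

text \<open>By \<open>roots_bounded\<close> the critical points stay in one disc; evaluation is
  continuous on the compact product of \<open>S\<close> with this disc.\<close>

lemma critical_values_bounded:
  assumes "compact S" "coeffs_continuous_on S F"
    and deg: "\<And>x. x \<in> S \<Longrightarrow> degree (F x) = Suc m" and lead: "\<And>x. x \<in> S \<Longrightarrow> lead_coeff (F x) = 1"
  obtains R where "\<And>x w. x \<in> S \<Longrightarrow> w \<in> critical_values (F x) \<Longrightarrow> norm w \<le> R"
proof -
  obtain R where R: "\<And>x z. x \<in> S \<Longrightarrow> poly (pderiv (F x)) z = 0 \<Longrightarrow> norm z \<le> R"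
  proof (rule roots_bounded[of S "\<lambda>x. pderiv (F x)" "of_nat (Suc m)" m])
    show "lead_coeff (pderiv (F x)) = of_nat (Suc m)" if "x \<in> S" for x
      using lead_coeff_pderiv[OF deg[OF that]] lead[OF that] by simp
    show "of_nat (Suc m) \<noteq> (0 :: complex)" by (simp only: of_nat_eq_0_iff)
  qed (use assms(1,2) deg in \<open>auto intro: coeffs_continuous_on_pderiv simp: degree_pderiv\<close>)
  have "continuous_on (S \<times> cball 0 R) (\<lambda>y. poly (F (fst y)) (snd y))"
    using deg
    by (intro continuous_on_poly_family[of _ "\<lambda>y. F (fst y)" _ "Suc m"] coeffs_continuous_on_compose[OF assms(2)] continuous_intros) auto
  then have "compact ((\<lambda>y. poly (F (fst y)) (snd y)) ` (S \<times> cball 0 R))"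
    using assms(1) by (intro compact_continuous_image compact_Times) auto
  then have "bounded ((\<lambda>y. poly (F (fst y)) (snd y)) ` (S \<times> cball 0 R))" by (rule compact_imp_bounded)
  then obtain B where B: "\<forall>w \<in> (\<lambda>y. poly (F (fst y)) (snd y)) ` (S \<times> cball 0 R). norm w \<le> B"
    unfolding bounded_iff by blast
  have "norm w \<le> B" if "x \<in> S" "w \<in> critical_values (F x)" for x w
  proof -
    from that(2) obtain z where z: "poly (pderiv (F x)) z = 0" "w = poly (F x) z"
      by (auto simp: critical_values_def critical_points_def)
    have "(x, z) \<in> S \<times> cball 0 R" using that(1) R[OF that(1) z(1)] by simp
    then show ?thesis using B z(2) by force
  qed
  then show ?thesis using that by blast
qed

lemma homotopic_paths_Pair:
  assumes "homotopic_paths S p q" "homotopic_paths T p' q'"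
  shows "homotopic_paths (S \<times> T) (\<lambda>t. (p t, p' t)) (\<lambda>t. (q t, q' t))"
proof -
  obtain h where h: "continuous_on ({0..1} \<times> {0..1}) h" "h \<in> {0..1} \<times> {0..1} \<rightarrow> S"
    "\<forall>x\<in>{0..1}. h (0, x) = p x" "\<forall>x\<in>{0..1}. h (1, x) = q x"
    "\<forall>t\<in>{0..1::real}. pathstart (h \<circ> Pair t) = pathstart p \<and> pathfinish (h \<circ> Pair t) = pathfinish p"
    using assms(1) unfolding homotopic_paths by blast
  obtain k where k: "continuous_on ({0..1} \<times> {0..1}) k" "k \<in> {0..1} \<times> {0..1} \<rightarrow> T"
    "\<forall>x\<in>{0..1}. k (0, x) = p' x" "\<forall>x\<in>{0..1}. k (1, x) = q' x"
    "\<forall>t\<in>{0..1::real}. pathstart (k \<circ> Pair t) = pathstart p' \<and> pathfinish (k \<circ> Pair t) = pathfinish p'"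
    using assms(2) unfolding homotopic_paths by blast
  show ?thesis
    unfolding homotopic_paths
    by (rule exI[of _ "\<lambda>x. (h x, k x)"])
      (use h k in \<open>auto simp: pathstart_def pathfinish_def intro: continuous_on_Pair\<close>)
qed

section \<open>Deformation into a fibre\<close>

text \<open>The first coordinate contracts the loop \<open>f\<close> linearly to the constant loop
  at \<open>f 0\<close>; the second is the time along the loop.\<close>

definition blend :: "(real \<Rightarrow> complex poly) \<Rightarrow> real \<times> real \<Rightarrow> complex poly" where
  "blend f y = Polynomial.smult (of_real (1 - fst y)) (f (snd y)) + Polynomial.smult (of_real (fst y)) (f 0)"

text \<open>The space of pairs of a polynomial and a noncritical value, pulled back to the square of
  blend parameters.\<close>

definition blend_space :: "(real \<Rightarrow> complex poly) \<Rightarrow> (real \<times> real \<times> complex) set" where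
  "blend_space f = {(\<sigma>, \<tau>, w). \<sigma> \<in> {0..1} \<and> \<tau> \<in> {0..1} \<and> w \<notin> critical_values (blend f (\<sigma>, \<tau>))}"

lemma blend_boundary:
  assumes "f 1 = f 0" "fst y = 1 \<or> snd y \<in> {0, 1}"
  shows "blend f y = f 0"
  using assms by (auto simp: blend_def smult_diff_left)

lemma blend_0: "blend f (0, \<tau>) = f \<tau>"
  by (simp add: blend_def)

lemma blend_monic:
  assumes "degree (f \<tau>) = n" "lead_coeff (f \<tau>) = 1" "degree (f 0) = n" "lead_coeff (f 0) = 1"
  shows "degree (blend f (\<sigma>, \<tau>)) = n" "lead_coeff (blend f (\<sigma>, \<tau>)) = 1"
proof -
  have c: "coeff (blend f (\<sigma>, \<tau>)) n = 1" using assms by (simp add: blend_def)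
  have "degree (blend f (\<sigma>, \<tau>)) \<le> n"
    unfolding blend_def using assms(1,3) by (intro degree_add_le order_trans[OF degree_smult_le]) auto
  moreover have "n \<le> degree (blend f (\<sigma>, \<tau>))" using c by (intro le_degree) auto
  ultimately show "degree (blend f (\<sigma>, \<tau>)) = n" by simp
  with c show "lead_coeff (blend f (\<sigma>, \<tau>)) = 1" by simp
qed

lemma coeffs_continuous_on_blend:
  assumes "coeffs_continuous_on {0..1} f"
  shows "coeffs_continuous_on ({0..1} \<times> {0..1}) (blend f)"
  unfolding blend_def
  by (intro coeffs_continuous_on_add coeffs_continuous_on_smult coeffs_continuous_on_const
      coeffs_continuous_on_compose[OF assms] continuous_intros) auto

text \<open>The \<open>m\<close> critical points are simple roots of \<open>pderiv (f t)\<close> and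
  move continuously; their images under \<open>f t\<close> stay distinct, so an ambient isotopy
  follows them.\<close>

lemma critical_values_trivialization:
  assumes "m > 0" and cont: "coeffs_continuous_on {0..1} f"
    and deg: "\<And>t. t \<in> {0..1} \<Longrightarrow> degree (f t) = Suc m"
    and lead: "\<And>t. t \<in> {0..1} \<Longrightarrow> lead_coeff (f t) = 1"
    and good: "\<And>t. t \<in> {0..1} \<Longrightarrow> card (critical_values (f t)) = m"
  obtains \<phi> \<psi> :: "real \<Rightarrow> complex \<Rightarrow> complex" and R where
    "continuous_on ({0..1} \<times> UNIV) (\<lambda>x. \<phi> (fst x) (snd x))"
    "continuous_on ({0..1} \<times> UNIV) (\<lambda>x. \<psi> (fst x) (snd x))"
    "\<And>\<tau> z. \<tau> \<in> {0..1} \<Longrightarrow> \<phi> \<tau> (\<psi> \<tau> z) = z"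
    "\<And>\<tau> z. \<tau> \<in> {0..1} \<Longrightarrow> \<psi> \<tau> (\<phi> \<tau> z) = z"
    "\<And>z. \<phi> 0 z = z"
    "\<And>\<tau> z. \<tau> \<in> {0..1} \<Longrightarrow> norm z \<ge> R \<Longrightarrow> \<phi> \<tau> z = z"
    "\<And>\<tau> z. \<tau> \<in> {0..1} \<Longrightarrow> \<phi> \<tau> z \<in> critical_values (f \<tau>) \<longleftrightarrow> z \<in> critical_values (f 0)"
proof -
  have crit: "critical_points (f t) = {z. poly (pderiv (f t)) z = 0}" for t
    by (simp add: critical_points_def)
  interpret crit: simple_root_family "{0..1}" "\<lambda>t. pderiv (f t)" m "of_nat (Suc m)"
  proof
    show "coeffs_continuous_on {0..1} (\<lambda>t. pderiv (f t))" by (rule coeffs_continuous_on_pderiv[OF cont])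
    show "(of_nat (Suc m) :: complex) \<noteq> 0" by (simp only: of_nat_eq_0_iff)
    fix t :: real assume t: "t \<in> {0..1}"
    show "degree (pderiv (f t)) = m" using deg[OF t] by (simp add: degree_pderiv)
    show "lead_coeff (pderiv (f t)) = of_nat (Suc m)"
      using lead_coeff_pderiv[OF deg[OF t]] lead[OF t] by simp
    show "card {z. poly (pderiv (f t)) z = 0} = m"
      using critical_points_simple(1)[OF deg[OF t] good[OF t]] by (simp add: crit)
  qed fact
  define I where "I = critical_points (f 0)"
  obtain \<rho> where \<rho>: "\<And>r. poly (pderiv (f 0)) r = 0 \<Longrightarrow> continuous_on {0..1} (\<rho> r)"
    "\<And>r. poly (pderiv (f 0)) r = 0 \<Longrightarrow> \<rho> r 0 = r"
    "\<And>t. t \<in> {0..1} \<Longrightarrow> bij_betw (\<lambda>r. \<rho> r t) {r. poly (pderiv (f 0)) r = 0} {z. poly (pderiv (f t)) z = 0}"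
    using crit.root_functions[of 0] by auto
  define a where "a r t = poly (f t) (\<rho> r t)" for r t
  have cv: "critical_values (f t) = (\<lambda>r. a r t) ` I" if "t \<in> {0..1}" for t
    using bij_betw_imp_surj_on[OF \<rho>(3)[OF that]]
    unfolding critical_values_def a_def I_def crit by (metis image_image)
  have "moving_trivial I a 0 1"
  proof (rule moving_trivial_unit)
    show "finite I" unfolding I_def using deg[of 0] by (intro finite_critical_points) simp
    show "continuous_on {0..1} (a r)" if "r \<in> I" for r
      unfolding a_def using that deg by (intro continuous_on_poly_family[OF cont \<rho>(1)]) (auto simp: I_def crit)
    show "a i t \<noteq> a j t" if "i \<in> I" "j \<in> I" "i \<noteq> j" "t \<in> {0..1}" for i j t
    proof
      assume "a i t = a j t"
      moreover have "\<rho> i t \<in> critical_points (f t)" "\<rho> j t \<in> critical_points (f t)"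
        using bij_betw_apply[OF \<rho>(3)[OF that(4)]] that(1,2) by (auto simp: I_def crit)
      ultimately have "\<rho> i t = \<rho> j t"
        using critical_points_simple(2)[OF deg good, OF that(4,4)] unfolding a_def inj_on_def by blast
      then have "i = j"
        using bij_betw_imp_inj_on[OF \<rho>(3)[OF that(4)]] that(1,2) unfolding inj_on_def I_def crit by blast
      with that(3) show False ..
    qed
  qed
  then obtain \<phi> \<psi> :: "real \<Rightarrow> complex \<Rightarrow> complex" and R where *:
     "continuous_on ({0..1} \<times> UNIV) (\<lambda>x. \<phi> (fst x) (snd x))"
     "continuous_on ({0..1} \<times> UNIV) (\<lambda>x. \<psi> (fst x) (snd x))"
     "\<forall>\<tau>\<in>{0..1}. \<forall>z. \<phi> \<tau> (\<psi> \<tau> z) = z \<and> \<psi> \<tau> (\<phi> \<tau> z) = z"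
     "\<forall>\<tau>\<in>{0..1}. \<forall>i\<in>I. \<phi> \<tau> (a i 0) = a i \<tau>"
     "\<forall>z. \<phi> 0 z = z"
     "\<forall>\<tau>\<in>{0..1}. \<forall>z. norm z \<ge> R \<longrightarrow> \<phi> \<tau> z = z"
    unfolding moving_trivial_def by blast
  have "\<phi> \<tau> z \<in> critical_values (f \<tau>) \<longleftrightarrow> z \<in> critical_values (f 0)" if \<tau>: "\<tau> \<in> {0..1}" for \<tau> z
  proof
    assume "\<phi> \<tau> z \<in> critical_values (f \<tau>)"
    then obtain i where i: "i \<in> I" "\<phi> \<tau> z = a i \<tau>" using cv[OF \<tau>] by auto
    then have "\<phi> \<tau> z = \<phi> \<tau> (a i 0)" using *(4) \<tau> by auto
    then have "z = a i 0" using *(3) \<tau> by metis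
    then show "z \<in> critical_values (f 0)" using cv[of 0] i by auto
  next
    assume "z \<in> critical_values (f 0)"
    then obtain i where "i \<in> I" "z = a i 0" using cv[of 0] by auto
    then show "\<phi> \<tau> z \<in> critical_values (f \<tau>)" using *(4) \<tau> cv[OF \<tau>] by auto
  qed
  then show ?thesis using that[of \<phi> \<psi> R] * by blast
qed

section \<open>Concatenation and homotopy of paths\<close>

lemma joinpaths_Pair: "(\<lambda>t. ((g +++ h) t, (g' +++ h') t)) = (\<lambda>t. (g t, g' t)) +++ (\<lambda>t. (h t, h' t))"
  by (auto simp: joinpaths_def fun_eq_iff)

lemma joinpaths_compose: "k \<circ> (g +++ h) = (k \<circ> g) +++ (k \<circ> h)"
  by (auto simp: joinpaths_def fun_eq_iff)

text \<open>The added tail runs along \<open>v\<close> to \<open>w\<close>, pauses there and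
  returns. During the pause the other coordinate of a pair can move.\<close>

lemma homotopic_paths_detour:
  assumes "path u" "path_image u \<subseteq> V" "path v" "path_image v \<subseteq> V" "pathfinish u = pathstart v"
    "w = pathfinish v"
  shows "homotopic_paths V u ((u +++ v) +++ (linepath w w +++ reversepath v))"
proof -
  have "homotopic_paths V (linepath w w +++ reversepath v) (reversepath v)"
    using assms by (intro homotopic_paths_lid') auto
  then have "homotopic_paths V ((u +++ v) +++ (linepath w w +++ reversepath v)) ((u +++ v) +++ reversepath v)"
    using assms by (intro homotopic_paths_join) (auto simp: subset_path_image_join)
  also have "homotopic_paths V ((u +++ v) +++ reversepath v) (u +++ (v +++ reversepath v))"
    using assms by (intro homotopic_paths_sym[OF homotopic_paths_assoc]) auto
  also have "homotopic_paths V (u +++ (v +++ reversepath v)) (u +++ linepath (pathstart v) (pathstart v))"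
    using assms by (intro homotopic_paths_join homotopic_paths_rinv) auto
  also have "homotopic_paths V (u +++ linepath (pathstart v) (pathstart v)) u"
    using assms by (intro homotopic_paths_rid') auto
  finally show ?thesis by (rule homotopic_paths_sym)
qed

lemma homotopic_paths_convex:
  fixes g h :: "real \<Rightarrow> 'a::real_normed_vector"
  assumes "convex S" "path g" "path h" "path_image g \<subseteq> S" "path_image h \<subseteq> S"
    "pathstart h = pathstart g" "pathfinish h = pathfinish g"
  shows "homotopic_paths S g h"
  using assms
  by (intro homotopic_paths_linear closed_segment_subset) (auto simp: path_image_def)

text \<open>By \<open>blend_boundary\<close>, the condition on \<open>\<mu>\<close> means that the
  polynomial is constantly \<open>f 0\<close> along \<open>\<mu>\<close>, so only the value
  moves.\<close>

lemma loop_slides_into_fibre: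
  assumes "m > 0" and cont: "coeffs_continuous_on {0..1} f"
    and deg: "\<And>t. t \<in> {0..1} \<Longrightarrow> degree (f t) = Suc m"
    and lead: "\<And>t. t \<in> {0..1} \<Longrightarrow> lead_coeff (f t) = 1"
    and good: "\<And>t. t \<in> {0..1} \<Longrightarrow> card (critical_values (f t)) = m"
    and loop: "f 1 = f 0"
    and nz: "\<And>t. t \<in> {0..1} \<Longrightarrow> 0 \<notin> critical_values (f t)"
  obtains \<mu> where "homotopic_paths (blend_space f) (\<lambda>t. (0, t, 0)) \<mu>"
    "\<And>t. t \<in> {0..1} \<Longrightarrow> fst (\<mu> t) = 1 \<or> fst (snd (\<mu> t)) \<in> {0, 1}"
proof -
  obtain \<phi> \<psi> :: "real \<Rightarrow> complex \<Rightarrow> complex" and R where \<phi>: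
    "continuous_on ({0..1} \<times> UNIV) (\<lambda>x. \<phi> (fst x) (snd x))"
    "continuous_on ({0..1} \<times> UNIV) (\<lambda>x. \<psi> (fst x) (snd x))"
    "\<And>\<tau> z. \<tau> \<in> {0..1} \<Longrightarrow> \<phi> \<tau> (\<psi> \<tau> z) = z"
    "\<And>\<tau> z. \<tau> \<in> {0..1} \<Longrightarrow> \<psi> \<tau> (\<phi> \<tau> z) = z"
    "\<And>z. \<phi> 0 z = z"
    "\<And>\<tau> z. \<tau> \<in> {0..1} \<Longrightarrow> norm z \<ge> R \<Longrightarrow> \<phi> \<tau> z = z"
    "\<And>\<tau> z. \<tau> \<in> {0..1} \<Longrightarrow> \<phi> \<tau> z \<in> critical_values (f \<tau>) \<longleftrightarrow> z \<in> critical_values (f 0)"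
    by (rule critical_values_trivialization[of m f]) (assumption | rule assms(1-5) that | blast)+
  obtain B where B: "\<And>y w. y \<in> {0..1} \<times> {0..1} \<Longrightarrow> w \<in> critical_values (blend f y) \<Longrightarrow> norm w \<le> B"
  proof (rule critical_values_bounded)
    show "compact ({0..1} \<times> {0..1} :: (real \<times> real) set)" by (intro compact_Times compact_Icc)
    show "coeffs_continuous_on ({0..1} \<times> {0..1}) (blend f)" by (rule coeffs_continuous_on_blend[OF cont])
    fix y :: "real \<times> real" assume "y \<in> {0..1} \<times> {0..1}"
    then show "degree (blend f y) = Suc m" "lead_coeff (blend f y) = 1"
      using blend_monic[of f "snd y" "Suc m" "fst y"] deg[of "snd y"] deg[of 0] lead[of "snd y"] lead[of 0] by auto
  qed blast
  \<comment> \<open>Outside the support of the isotopy, hence fixed by it, and larger in norm than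
    every critical value of every blend.\<close>
  define w where "w = complex_of_real (max R (B + 1))"
  have "norm w \<ge> R" "norm w > B" unfolding w_def by (auto simp: abs_if)
  then have w_far: "w \<notin> critical_values (blend f y)" if "y \<in> {0..1} \<times> {0..1}" for y
    using B[OF that] by force
  have \<phi>w: "\<phi> \<tau> w = w" if "\<tau> \<in> {0..1}" for \<tau> using \<phi>(6)[OF that \<open>norm w \<ge> R\<close>] .
  define V where "V = - critical_values (f 0)"
  have "w \<in> V" using w_far[of "(0, 0)"] by (simp add: V_def blend_0)
  define u where "u t = \<psi> t 0" for t
  have "path u"
    unfolding path_def u_def by (intro continuous_on_compose2_prod[OF \<phi>(2)] continuous_intros) auto
  have uV: "u t \<in> V" if "t \<in> {0..1}" for t
    using \<phi>(7)[OF that, of "u t"] \<phi>(3)[OF that, of 0] nz[OF that] by (simp add: V_def u_def)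
  then have "path_image u \<subseteq> V" by (auto simp: path_image_def)
  have "path_connected V"
    unfolding V_def using deg[of 0]
    by (intro path_connected_complement_countable countable_finite finite_critical_values) auto
  then obtain v where v: "path v" "path_image v \<subseteq> V" "pathstart v = u 1" "pathfinish v = w"
    using uV[of 1] \<open>w \<in> V\<close> unfolding path_connected_def by force
  \<comment> \<open>On the side with first coordinate 0 this straightens the space into a product,
    where time and value can be deformed independently.\<close>
  define \<Psi> where "\<Psi> = (\<lambda>y :: real \<times> complex. (0 :: real, fst y, \<phi> (fst y) (snd y)))"
  have cont\<Psi>: "continuous_on ({0..1} \<times> V) \<Psi>"
    unfolding \<Psi>_def by (intro continuous_intros continuous_on_subset[OF \<phi>(1)]) auto
  have \<Psi>X: "\<Psi> \<in> {0..1} \<times> V \<rightarrow> blend_space f"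
    using \<phi>(7) by (auto simp: \<Psi>_def blend_space_def blend_0 V_def)
  \<comment> \<open>Time waits at 0 while the value follows \<open>u\<close> and \<open>v\<close> to
    \<open>w\<close>, runs from 0 to 1 while the value rests at \<open>w\<close>, and stays at 1
    while the value returns along \<open>v\<close>.\<close>
  let ?j = "linepath 0 0 +++ (linepath 0 1 +++ linepath 1 1) :: real \<Rightarrow> real"
  let ?u = "(u +++ v) +++ (linepath w w +++ reversepath v)"
  have "homotopic_paths {0..1} (linepath 0 1) ?j"
    by (rule homotopic_paths_convex) (auto simp: path_image_join closed_segment_eq_real_ivl)
  moreover have "homotopic_paths V u ?u"
    using v \<open>path u\<close> \<open>path_image u \<subseteq> V\<close> by (intro homotopic_paths_detour) (auto simp: pathfinish_def)
  ultimately have "homotopic_paths ({0..1} \<times> V) (\<lambda>t. (linepath 0 1 t, u t)) (\<lambda>t. (?j t, ?u t))"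
    by (rule homotopic_paths_Pair)
  then have hom1: "homotopic_paths (blend_space f) (\<Psi> \<circ> (\<lambda>t. (linepath 0 1 t, u t))) (\<Psi> \<circ> (\<lambda>t. (?j t, ?u t)))"
    using cont\<Psi> \<Psi>X by (rule homotopic_paths_continuous_image)
  define A where "A = \<Psi> \<circ> (\<lambda>t. (linepath 0 0 t, (u +++ v) t))"
  define B0 where "B0 = \<Psi> \<circ> (\<lambda>t. (linepath 0 1 t, linepath w w t))"
  define C where "C = \<Psi> \<circ> (\<lambda>t. (linepath 1 1 t, reversepath v t))"
  have split: "\<Psi> \<circ> (\<lambda>t. (?j t, ?u t)) = A +++ (B0 +++ C)"
    unfolding joinpaths_Pair joinpaths_compose A_def B0_def C_def ..
  \<comment> \<open>The other three sides of the parameter square at height \<open>w\<close>. The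
    whole square \<open>Z\<close> at this height avoids the critical values, so \<open>B0\<close>
    can be pushed across it.\<close>
  define B1 where "B1 = linepath (0, 0, w) (1, 0, w) +++ (linepath (1, 0, w) (1, 1, w) +++ linepath (1 :: real, 1 :: real, w) (0, 1, w))"
  define Z where "Z = {0..1 :: real} \<times> {0..1 :: real} \<times> {w}"
  have "convex Z" unfolding Z_def by (intro convex_Times) auto
  have "Z \<subseteq> blend_space f" using w_far by (auto simp: Z_def blend_space_def)
  have linZ: "path_image (linepath x y) \<subseteq> Z" if "x \<in> Z" "y \<in> Z" for x y
    using that \<open>convex Z\<close> by (simp add: closed_segment_subset)
  have B1_Z: "path_image B1 \<subseteq> Z"
    unfolding B1_def by (intro subset_path_image_join linZ) (auto simp: Z_def)
  have \<Psi>_path: "homotopic_paths (blend_space f) (\<Psi> \<circ> (\<lambda>t. (p t, q t))) (\<Psi> \<circ> (\<lambda>t. (p t, q t)))"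
    if "path p" "path_image p \<subseteq> {0..1}" "path q" "path_image q \<subseteq> V" for p q
    using that by (intro homotopic_paths_continuous_image[OF homotopic_paths_Pair cont\<Psi> \<Psi>X]) auto
  have hA: "homotopic_paths (blend_space f) A A"
    unfolding A_def using v \<open>path u\<close> \<open>path_image u \<subseteq> V\<close>
    by (intro \<Psi>_path subset_path_image_join path_join_imp path_linepath)
      (auto simp: pathfinish_def[of u])
  have hB0: "homotopic_paths (blend_space f) B0 B0"
    unfolding B0_def using \<open>w \<in> V\<close> by (intro \<Psi>_path path_linepath) (auto simp: path_image_def linepath_def)
  have hC: "homotopic_paths (blend_space f) C C"
    unfolding C_def using v by (intro \<Psi>_path path_linepath) (auto simp: path_image_def[of "linepath _ _"] linepath_def)
  have B0_eq: "B0 t = (0, t, w)" if "t \<in> {0..1}" for t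
    using that \<phi>w by (simp add: B0_def \<Psi>_def linepath_def)
  have "homotopic_paths Z B0 B1"
  proof (rule homotopic_paths_convex[OF \<open>convex Z\<close> _ _ _ B1_Z])
    show "path B0" using hB0 by simp
    show "path B1" by (simp add: B1_def)
    show "path_image B0 \<subseteq> Z" using B0_eq by (auto simp: path_image_def Z_def)
  qed (auto simp: B1_def pathstart_def[of B0] pathfinish_def[of B0] B0_eq)
  then have hB: "homotopic_paths (blend_space f) B0 B1"
    using \<open>Z \<subseteq> blend_space f\<close> by (rule homotopic_paths_subset)
  have ends: "pathfinish A = (0, 0, w)" "pathstart B0 = (0, 0, w)"
    "pathfinish B0 = (0, 1, w)" "pathstart C = (0, 1, w)"
    using v(4) \<phi>w by (auto simp: A_def B0_def C_def \<Psi>_def pathfinish_def pathstart_def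
        joinpaths_def linepath_def reversepath_def)
  define \<mu> where "\<mu> = A +++ (B1 +++ C)"
  have "homotopic_paths (blend_space f) (A +++ (B0 +++ C)) \<mu>"
    unfolding \<mu>_def using ends by (intro homotopic_paths_join hA hB hC) auto
  with hom1 have "homotopic_paths (blend_space f) (\<Psi> \<circ> (\<lambda>t. (linepath 0 1 t, u t))) \<mu>"
    unfolding split by (rule homotopic_paths_trans)
  moreover have "homotopic_paths (blend_space f) (\<Psi> \<circ> (\<lambda>t. (linepath 0 1 t, u t))) (\<lambda>t. (0, t, 0))"
  proof (rule homotopic_paths_eq)
    show "path (\<Psi> \<circ> (\<lambda>t. (linepath 0 1 t, u t)))"
      "path_image (\<Psi> \<circ> (\<lambda>t. (linepath 0 1 t, u t))) \<subseteq> blend_space f"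
      using homotopic_paths_imp_path[OF hom1] homotopic_paths_imp_subset[OF hom1] by auto
    show "(\<Psi> \<circ> (\<lambda>t. (linepath 0 1 t, u t))) t = (0, t, 0)" if "t \<in> {0..1}" for t
      using \<phi>(3)[OF that] by (simp add: \<Psi>_def linepath_def u_def)
  qed
  ultimately have "homotopic_paths (blend_space f) (\<lambda>t. (0, t, 0)) \<mu>"
    by (meson homotopic_paths_sym homotopic_paths_trans)
  \<comment> \<open>\<open>A\<close> stays at time 0 and \<open>C\<close> at time 1; the three
    segments of \<open>B1\<close> stay at time 0, at blend parameter 1 and at time 1.\<close>
  moreover have "fst (\<mu> t) = 1 \<or> fst (snd (\<mu> t)) \<in> {0, 1}" if "t \<in> {0..1}" for t
  proof -
    have "\<mu> t \<in> path_image \<mu>" using that by (auto simp: path_image_def)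
    also have "\<dots> \<subseteq> path_image A \<union> (path_image B1 \<union> path_image C)"
      unfolding \<mu>_def by (intro order_trans[OF path_image_join_subset] Un_mono order_refl)
    finally consider "\<mu> t \<in> path_image A" | "\<mu> t \<in> path_image B1" | "\<mu> t \<in> path_image C" by blast
    then show ?thesis
    proof cases
      case 1
      then show ?thesis by (auto simp: A_def path_image_def \<Psi>_def linepath_def)
    next
      case 2
      then have "\<mu> t \<in> closed_segment (0, 0, w) (1, 0, w) \<union> (closed_segment (1, 0, w) (1, 1, w)
        \<union> closed_segment (1, 1, w) (0, 1, w))"
        unfolding B1_def by (simp add: path_image_join)
      then show ?thesis by (auto simp: closed_segment_def)
    next
      case 3
      then show ?thesis by (auto simp: C_def path_image_def \<Psi>_def linepath_def)
    qed
  qed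
  ultimately show ?thesis by (rule that)
qed

section \<open>Generic braids\<close>

lemma prod_linear_monic:
  fixes c :: "'k \<Rightarrow> complex"
  shows "degree (\<Prod>k\<in>K. [:- c k, 1:]) = card K" "lead_coeff (\<Prod>k\<in>K. [:- c k, 1:]) = 1"
  by (subst degree_prod_eq_sum_degree) (auto simp: lead_coeff_prod)

lemma roots_prod_linear:
  fixes c :: "'k \<Rightarrow> complex"
  assumes "finite K"
  shows "{z. poly (\<Prod>k\<in>K. [:- c k, 1:]) z = 0} = c ` K"
  using assms by (auto simp: poly_prod)

text \<open>Real and imaginary parts are real polynomials in \<open>t\<close>; as one complex
  polynomial, the path extends to complex times.\<close>

lemma polynomial_function_complex_poly:
  fixes g :: "real \<Rightarrow> complex"
  assumes "polynomial_function g"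
  obtains B where "\<And>t. g t = poly B (complex_of_real t)"
proof -
  have "real_polynomial_function (Re \<circ> g)" "real_polynomial_function (Im \<circ> g)"
    using assms bounded_linear_Re bounded_linear_Im unfolding polynomial_function_def by blast+
  then obtain a n b m where re: "Re \<circ> g = (\<lambda>x. \<Sum>i\<le>n. a i * x ^ i)" and im: "Im \<circ> g = (\<lambda>x. \<Sum>i\<le>m. b i * x ^ i)"
    unfolding real_polynomial_function_iff_sum by blast
  define B where "B = (\<Sum>i\<le>n. monom (complex_of_real (a i)) i) + Polynomial.smult \<i> (\<Sum>i\<le>m. monom (complex_of_real (b i)) i)"
  have "g t = poly B (complex_of_real t)" for t
  proof -
    have "g t = of_real ((Re \<circ> g) t) + \<i> * of_real ((Im \<circ> g) t)" by (simp add: complex_eq_iff)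
    then show ?thesis unfolding re im by (simp add: B_def poly_sum poly_monom)
  qed
  then show ?thesis using that by blast
qed

lemma geom_braid_endpoint_bij:
  assumes "finite K" "geom_braid K b"
  shows "bij_betw (\<lambda>k. b k 1) K K"
proof -
  have "inj_on (\<lambda>k. b k 1) K" "(\<lambda>k. b k 1) ` K \<subseteq> K"
    using assms(2) by (fastforce simp: geom_braid_def inj_on_def)+
  then show ?thesis using assms(1) by (simp add: bij_betw_def endo_inj_surj)
qed

text \<open>Polynomial paths with the same end points approximate the strands to within half of
  their separation \<open>r\<close>, so linear interpolation causes no collisions.\<close>

lemma isotopic_to_polynomial_braid:
  assumes "finite K" "geom_braid K b"
  obtains B where "geom_braid K (\<lambda>k t. poly (B k) (complex_of_real t))"
    "braid_isotopic K b (\<lambda>k t. poly (B k) (complex_of_real t))"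
    "\<And>k. k \<in> K \<Longrightarrow> poly (B k) 0 = k" "\<And>k. k \<in> K \<Longrightarrow> poly (B k) 1 = b k 1"
proof -
  have b: "path (b k)" "b k 0 = k" "b k 1 \<in> K" if "k \<in> K" for k
    using assms(2) that by (auto simp: geom_braid_def)
  obtain r where r: "r > 0"
    "\<And>i j t. i \<in> K \<Longrightarrow> j \<in> K \<Longrightarrow> i \<noteq> j \<Longrightarrow> t \<in> {0..1} \<Longrightarrow> r \<le> dist (b i t) (b j t)"
    using uniform_separation[of K b] assms by (auto simp: geom_braid_def path_def)
  have "\<forall>k. \<exists>B. k \<in> K \<longrightarrow> poly B 0 = k \<and> poly B 1 = b k 1 \<and>
      (\<forall>t\<in>{0..1}. norm (poly B (complex_of_real t) - b k t) < r / 2)"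
  proof (intro allI)
    fix k
    show "\<exists>B. k \<in> K \<longrightarrow> poly B 0 = k \<and> poly B 1 = b k 1 \<and>
      (\<forall>t\<in>{0..1}. norm (poly B (complex_of_real t) - b k t) < r / 2)"
    proof (cases "k \<in> K")
      case True
      obtain g where g: "polynomial_function g" "pathstart g = pathstart (b k)" "pathfinish g = pathfinish (b k)"
        "\<And>t. t \<in> {0..1} \<Longrightarrow> norm (g t - b k t) < r / 2"
        using path_approx_polynomial_function[OF b(1)[OF True], of "r / 2"] r(1) by auto
      obtain B where B: "\<And>t. g t = poly B (complex_of_real t)"
        using polynomial_function_complex_poly[OF g(1)] by blast
      show ?thesis
        using g(2-4) b(2)[OF True] B[of 0] B[of 1]
        by (intro exI[of _ B]) (auto simp: pathstart_def pathfinish_def B[symmetric])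
    qed auto
  qed
  from choice[OF this] obtain B where B: "\<And>k. k \<in> K \<Longrightarrow> poly (B k) 0 = k" "\<And>k. k \<in> K \<Longrightarrow> poly (B k) 1 = b k 1"
    "\<And>k t. k \<in> K \<Longrightarrow> t \<in> {0..1} \<Longrightarrow> norm (poly (B k) (complex_of_real t) - b k t) < r / 2" by blast
  define H where "H s k t = b k t + s *\<^sub>R (poly (B k) (complex_of_real t) - b k t)" for s k t
  have contB: "continuous_on {0..1} (\<lambda>t. poly (B k) (complex_of_real t))" for k
    by (intro continuous_intros)
  have H_braid: "geom_braid K (H s)" if s: "s \<in> {0..1}" for s
    unfolding geom_braid_def
  proof (intro conjI ballI impI)
    fix k assume k: "k \<in> K"
    show "path (H s k)" using b(1)[OF k] contB unfolding path_def H_def by (intro continuous_intros)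
    show "H s k 0 = k" using b(2)[OF k] B(1)[OF k] by (simp add: H_def)
    show "H s k 1 \<in> K" using b(3)[OF k] B(2)[OF k] by (simp add: H_def)
  next
    fix t :: real and k l assume t: "t \<in> {0..1}" and kl: "k \<in> K" "l \<in> K" "k \<noteq> l"
    have near: "dist (H s i t) (b i t) < r / 2" if "i \<in> K" for i
    proof -
      have "dist (H s i t) (b i t) = s * norm (poly (B i) (complex_of_real t) - b i t)"
        using s by (simp add: H_def dist_norm)
      also have "\<dots> \<le> norm (poly (B i) (complex_of_real t) - b i t)"
        using s by (intro mult_left_le_one_le) auto
      finally show ?thesis using B(3)[OF that t] by simp
    qed
    show "H s k t \<noteq> H s l t"
    proof
      assume "H s k t = H s l t"
      then have "dist (b k t) (b l t) < r"
        using near[OF kl(1)] near[OF kl(2)] dist_triangle_half_r[of "H s k t" "b k t" r "b l t"] by simp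
      then show False using r(2)[OF kl t] by simp
    qed
  qed
  have "geom_braid K (\<lambda>k t. poly (B k) (complex_of_real t))"
  proof -
    have "H 1 = (\<lambda>k t. poly (B k) (complex_of_real t))" by (simp add: H_def fun_eq_iff)
    then show ?thesis using H_braid[of 1] by simp
  qed
  moreover have "braid_isotopic K b (\<lambda>k t. poly (B k) (complex_of_real t))"
  proof (rule braid_isotopicI[where H = H])
    fix k assume k: "k \<in> K"
    have "continuous_on ({0..1} \<times> {0..1}) (\<lambda>x :: real \<times> real. b k (snd x))"
      using b(1)[OF k] unfolding path_def by (rule continuous_on_compose2) (auto intro!: continuous_intros)
    then show "continuous_on ({0..1} \<times> {0..1}) (\<lambda>x. H (fst x) k (snd x))"
      unfolding H_def by (intro continuous_intros)
  qed (use H_braid B(2) in \<open>auto simp: H_def\<close>)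
  ultimately show ?thesis using that B(1,2) by blast
qed

text \<open>A parabolic arc from 0 to 1 with height proportional to \<open>e\<close>;
  \<open>e = 0\<close> gives the real interval.\<close>

definition arc_point :: "real \<Rightarrow> real \<Rightarrow> complex" where
  "arc_point e t = of_real t + \<i> * of_real (e * (t * (1 - t)))"

text \<open>A point with real part strictly between 0 and 1 lies on exactly one of the arcs
  \<open>arc_point e\<close>.\<close>

lemma arc_point_avoids:
  assumes "finite W"
  obtains e where "e > 0"
    "\<And>e' t. 0 < e' \<Longrightarrow> e' \<le> e \<Longrightarrow> t \<in> {0..1} \<Longrightarrow> 0 \<notin> W \<Longrightarrow> 1 \<notin> W \<Longrightarrow> arc_point e' t \<notin> W"
proof -
  \<comment> \<open>\<open>h\<close> recovers the arc parameter from an interior point of an arc, so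
    its positive values on \<open>W\<close> are the parameters to avoid; \<open>e\<close> is chosen
    below all of them.\<close>
  define h where "h w = Im w / (Re w * (1 - Re w))" for w
  define P where "P = {x \<in> h ` W. x > 0}"
  have "finite P" unfolding P_def using assms by auto
  define e where "e = Min (insert 1 P) / 2"
  have "Min (insert 1 P) > 0" using \<open>finite P\<close> by (auto simp: P_def)
  then have "e > 0" by (simp add: e_def)
  have e: "e < x" if "x \<in> P" for x
  proof -
    have "Min (insert 1 P) \<le> x" using \<open>finite P\<close> that by (intro Min_le) auto
    then show ?thesis using \<open>Min (insert 1 P) > 0\<close> unfolding e_def by linarith
  qed
  note \<open>e > 0\<close>
  moreover have "arc_point e' t \<notin> W" if "0 < e'" "e' \<le> e" "t \<in> {0..1}" "0 \<notin> W" "1 \<notin> W" for e' t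
  proof
    assume W: "arc_point e' t \<in> W"
    then have "t \<noteq> 0" "t \<noteq> 1" using that(4,5) by (auto simp: arc_point_def)
    then have "h (arc_point e' t) = e'" by (simp add: h_def arc_point_def)
    then have "e' \<in> P" using W that(1) by (force simp: P_def)
    then show False using e that(2) by force
  qed
  ultimately show ?thesis by (rule that)
qed

text \<open>At both ends the strands occupy \<open>K\<close>, so the times 0 and 1 are neither
  degenerate nor collision times. The bad complex times are finitely many and a bent arc avoids
  them.\<close>

lemma isotopic_to_generic_braid:
  assumes "finite K" "card K = Suc m" "m > 0" "geom_braid K b"
    and good: "card (critical_values (\<Prod>k\<in>K. [:- k, 1:])) = m"
  obtains c where "geom_braid K c" "braid_isotopic K b c"
    "\<And>t. t \<in> {0..1} \<Longrightarrow> card (critical_values (\<Prod>k\<in>K. [:- c k t, 1:])) = m"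
proof -
  obtain B where B: "geom_braid K (\<lambda>k t. poly (B k) (complex_of_real t))"
    "braid_isotopic K b (\<lambda>k t. poly (B k) (complex_of_real t))"
    "\<And>k. k \<in> K \<Longrightarrow> poly (B k) 0 = k" "\<And>k. k \<in> K \<Longrightarrow> poly (B k) 1 = b k 1"
    using isotopic_to_polynomial_braid[OF assms(1,4)] by blast
  define f where "f x = (\<Prod>k\<in>K. [:- poly (B k) x, 1:])" for x
  define Z where "Z = {x. card (critical_values (f x)) \<noteq> m}"
  have f0: "f 0 = (\<Prod>k\<in>K. [:- k, 1:])" unfolding f_def by (intro prod.cong) (auto simp: B(3))
  have f1: "f 1 = (\<Prod>k\<in>K. [:- k, 1:])"
  proof -
    have "f 1 = (\<Prod>k\<in>K. [:- b k 1, 1:])" unfolding f_def by (intro prod.cong) (auto simp: B(4))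
    also have "\<dots> = (\<Prod>k\<in>K. [:- k, 1:])"
      by (rule prod.reindex_bij_betw[OF geom_braid_endpoint_bij[OF assms(1,4)]])
    finally show ?thesis .
  qed
  have "finite Z"
    unfolding Z_def
  proof (rule degenerate_parameters_finite[of f m 0])
    show "poly_family f" unfolding f_def by (intro poly_family_prod poly_family_linear)
    show "degree (f x) = Suc m" for x unfolding f_def by (simp only: prod_linear_monic(1) assms(2))
  qed (use f0 good assms(3) in auto)
  \<comment> \<open>The complex times at which two strands collide, finitely many since the strands
    start at different points.\<close>
  define W where "W = (\<Union>k\<in>K. \<Union>l\<in>K - {k}. {x. poly (B k - B l) x = 0})"
  have "finite W"
    unfolding W_def
  proof (intro finite_UN_I)
    fix k l assume "k \<in> K" "l \<in> K - {k}"
    then have "poly (B k - B l) 0 \<noteq> 0" by (auto simp: B(3))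
    then show "finite {x. poly (B k - B l) x = 0}" by (intro poly_roots_finite) auto
  qed (use assms(1) in auto)
  have W_real: "complex_of_real t \<notin> W" if "t \<in> {0..1}" for t
    using B(1) that unfolding geom_braid_def W_def by auto
  obtain e where e: "e > 0"
    "\<And>e' t. 0 < e' \<Longrightarrow> e' \<le> e \<Longrightarrow> t \<in> {0..1} \<Longrightarrow> 0 \<notin> W \<union> Z \<Longrightarrow> 1 \<notin> W \<union> Z \<Longrightarrow> arc_point e' t \<notin> W \<union> Z"
    using arc_point_avoids[of "W \<union> Z"] \<open>finite W\<close> \<open>finite Z\<close> by blast
  have "0 \<notin> W \<union> Z" "1 \<notin> W \<union> Z"
    using W_real[of 0] W_real[of 1] f0 f1 good by (auto simp: Z_def)
  with e(2) have avoid: "arc_point e' t \<notin> W \<union> Z" if "0 < e'" "e' \<le> e" "t \<in> {0..1}" for e' t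
    using that by blast
  \<comment> \<open>The arc is raised from height parameter 0 to \<open>e\<close>. At 0 the strands
    are disjoint because they form a braid, at positive heights because the arc avoids
    \<open>W\<close>.\<close>
  define H where "H s k t = poly (B k) (arc_point (s * e) t)" for s k t
  have H_braid: "geom_braid K (H s)" if s: "s \<in> {0..1}" for s
    unfolding geom_braid_def
  proof (intro conjI ballI impI)
    fix k assume k: "k \<in> K"
    show "path (H s k)" unfolding path_def H_def arc_point_def by (intro continuous_intros)
    show "H s k 0 = k" using B(3)[OF k] by (simp add: H_def arc_point_def)
    show "H s k 1 \<in> K" using B(4)[OF k] assms(4) k by (simp add: H_def arc_point_def geom_braid_def)
  next
    fix t :: real and k l assume t: "t \<in> {0..1}" and kl: "k \<in> K" "l \<in> K" "k \<noteq> l"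
    have "arc_point (s * e) t \<notin> W"
    proof (cases "s = 0")
      case True
      then show ?thesis using W_real[OF t] by (simp add: arc_point_def)
    next
      case False
      then show ?thesis using avoid[of "s * e" t] s t e(1) by (auto simp: mult_left_le_one_le)
    qed
    then show "H s k t \<noteq> H s l t" using kl by (auto simp: W_def H_def)
  qed
  have "braid_isotopic K (\<lambda>k t. poly (B k) (complex_of_real t)) (H 1)"
  proof (rule braid_isotopicI[where H = H])
    fix k assume "k \<in> K"
    show "continuous_on ({0..1} \<times> {0..1}) (\<lambda>x. H (fst x) k (snd x))"
      unfolding H_def arc_point_def by (intro continuous_intros)
  qed (use H_braid in \<open>auto simp: H_def arc_point_def\<close>)
  with B(2) have "braid_isotopic K b (H 1)" by (rule braid_isotopic_trans)
  moreover have "card (critical_values (\<Prod>k\<in>K. [:- H 1 k t, 1:])) = m" if "t \<in> {0..1}" for t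
    using avoid[OF e(1) order_refl that] by (simp add: Z_def f_def H_def)
  ultimately show ?thesis using that H_braid[of 1] by simp
qed

section \<open>From deformations to isotopies\<close>

lemma (in simple_root_family) pullback:
  fixes g :: "'b::real_normed_vector \<Rightarrow> 'a"
  assumes "continuous_on T g" "g ` T \<subseteq> S"
  shows "simple_root_family T (\<lambda>y. F (g y)) n c"
proof
  show "coeffs_continuous_on T (\<lambda>y. F (g y))" by (rule coeffs_continuous_on_compose[OF cont assms])
qed (use assms(2) deg lead simple n_pos c_nz in \<open>auto simp: image_subset_iff\<close>)

text \<open>The homotopy from \<open>loop_slides_into_fibre\<close> puts a polynomial with simple
  roots at each point of a square. Following its roots from \<open>K\<close> gives the isotopy; on
  the side \<open>s = 1\<close> the polynomial is \<open>Q\<close> minus a constant.\<close>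

lemma isotopic_to_lift:
  assumes "finite K" "card K = Suc m" "m > 0" and c: "geom_braid K c"
    and good: "\<And>t. t \<in> {0..1} \<Longrightarrow> card (critical_values (\<Prod>k\<in>K. [:- c k t, 1:])) = m"
    and Q: "Q = (\<Prod>k\<in>K. [:- k, 1:])"
  obtains d \<gamma> where "geom_braid K d" "braid_isotopic K c d" "path \<gamma>" "pathstart \<gamma> = 0" "pathfinish \<gamma> = 0"
    "\<And>t. t \<in> {0..1} \<Longrightarrow> \<gamma> t \<notin> critical_values Q"
    "\<And>k t. k \<in> K \<Longrightarrow> t \<in> {0..1} \<Longrightarrow> poly Q (d k t) = \<gamma> t"
proof -
  have ck: "path (c k)" "c k 0 = k" "c k 1 \<in> K" if "k \<in> K" for k
    using c that by (auto simp: geom_braid_def)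
  define f where "f t = (\<Prod>k\<in>K. [:- c k t, 1:])" for t
  have deg: "degree (f t) = Suc m" and lead: "lead_coeff (f t) = 1" for t
    unfolding f_def using prod_linear_monic[of "\<lambda>k. c k t" K] assms(2) by (simp_all only:)
  have cont: "coeffs_continuous_on {0..1} f"
    unfolding f_def using ck(1)
    by (intro coeffs_continuous_on_prod coeffs_continuous_on_pCons continuous_intros) (auto simp: path_def)
  have f0: "f 0 = Q" unfolding f_def Q by (intro prod.cong) (auto simp: ck(2))
  have f1: "f 1 = Q"
    unfolding f_def Q by (rule prod.reindex_bij_betw[OF geom_braid_endpoint_bij[OF assms(1) c]])
  have rootsQ: "{z. poly Q z = 0} = K" using roots_prod_linear[OF assms(1), of "\<lambda>k. k"] Q by simp
  have nz: "0 \<notin> critical_values (f t)" if t: "t \<in> {0..1}" for t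
  proof -
    have "inj_on (\<lambda>k. c k t) K" using c t unfolding geom_braid_def inj_on_def by blast
    then have "card {z. poly (f t) z = 0} = Suc m"
      unfolding f_def using roots_prod_linear[OF assms(1), of "\<lambda>k. c k t"] assms(2) by (simp add: card_image)
    then show ?thesis using card_roots_diff_const_iff[of "f t" 0] deg[of t] by simp
  qed
  obtain \<mu> where \<mu>: "homotopic_paths (blend_space f) (\<lambda>t. (0, t, 0)) \<mu>"
    "\<And>t. t \<in> {0..1} \<Longrightarrow> fst (\<mu> t) = 1 \<or> fst (snd (\<mu> t)) \<in> {0, 1}"
    using loop_slides_into_fibre[OF assms(3) cont deg lead _ _ nz] good f0 f1 unfolding f_def by metis
  obtain h where h: "continuous_on ({0..1} \<times> {0..1}) h" "h \<in> {0..1} \<times> {0..1} \<rightarrow> blend_space f"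
    "\<forall>x\<in>{0..1}. h (0, x) = (0, x, 0)" "\<forall>x\<in>{0..1}. h (1, x) = \<mu> x"
    "\<forall>t\<in>{0..1::real}. pathstart (h \<circ> Pair t) = pathstart (\<lambda>t. (0 :: real, t :: real, 0 :: complex)) \<and>
      pathfinish (h \<circ> Pair t) = pathfinish (\<lambda>t. (0, t, 0))"
    using \<mu>(1) unfolding homotopic_paths by blast
  have h_ends: "h (s, 0) = (0, 0, 0)" "h (s, 1) = (0, 1, 0)" if "s \<in> {0..1}" for s
    using h(5) that by (auto simp: pathstart_def pathfinish_def)
  define F where "F x = blend f (fst (h x), fst (snd (h x))) - [:snd (snd (h x)):]" for x
  define S where "S = {0..1::real} \<times> {0..1::real}"
  have hS: "fst (h x) \<in> {0..1}" "fst (snd (h x)) \<in> {0..1}"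
    "snd (snd (h x)) \<notin> critical_values (blend f (fst (h x), fst (snd (h x))))" if "x \<in> S" for x
    using h(2) that unfolding S_def blend_space_def by (auto simp: Pi_iff split_beta)
  interpret fam: simple_root_family S F "Suc m" 1
  proof
    show "coeffs_continuous_on S F"
      unfolding F_def
    proof (intro coeffs_continuous_on_diff coeffs_continuous_on_pCons)
      show "coeffs_continuous_on S (\<lambda>x. blend f (fst (h x), fst (snd (h x))))"
        using hS h(1)
        by (intro coeffs_continuous_on_compose[OF coeffs_continuous_on_blend[OF cont]] continuous_intros)
          (auto simp: S_def)
      show "continuous_on S (\<lambda>x. snd (snd (h x)))" using h(1) unfolding S_def by (intro continuous_intros)
    qed
    fix x assume x: "x \<in> S"
    have bd: "degree (blend f (fst (h x), fst (snd (h x)))) = Suc m"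
      "lead_coeff (blend f (fst (h x), fst (snd (h x)))) = 1"
      by (rule blend_monic[OF deg lead deg lead])+
    then show dF: "degree (F x) = Suc m" unfolding F_def by (subst degree_diff_const) auto
    have "coeff (F x) (Suc m) = 1" using bd unfolding F_def by simp
    then show "lead_coeff (F x) = 1" by (simp add: dF)
    show "card {z. poly (F x) z = 0} = Suc m"
      using card_roots_diff_const_iff[of "blend f (fst (h x), fst (snd (h x)))"] bd hS(3)[OF x]
      unfolding F_def by simp
  qed auto
  have FQ: "F (s, 0) = Q" "F (s, 1) = Q" if "s \<in> {0..1}" for s
    using h_ends[OF that] f0 f1 by (auto simp: F_def blend_0)
  have F0: "F (0, t) = f t" if "t \<in> {0..1}" for t
    using h(3) that by (simp add: F_def blend_0)
  have "convex S" unfolding S_def by (intro convex_Times) auto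
  moreover have "(0, 0) \<in> S" by (simp add: S_def)
  ultimately obtain \<rho> where \<rho>': "\<And>k. poly (F (0, 0)) k = 0 \<Longrightarrow> continuous_on S (\<rho> k)"
    "\<And>k. poly (F (0, 0)) k = 0 \<Longrightarrow> \<rho> k (0, 0) = k"
    "\<And>x. x \<in> S \<Longrightarrow> bij_betw (\<lambda>k. \<rho> k x) {k. poly (F (0, 0)) k = 0} {z. poly (F x) z = 0}"
    using fam.root_functions[of "(0, 0)"] by blast
  have K: "{k. poly (F (0, 0)) k = 0} = K" using FQ(1)[of 0] rootsQ by simp
  then have \<rho>: "\<And>k. k \<in> K \<Longrightarrow> continuous_on S (\<rho> k)" "\<And>k. k \<in> K \<Longrightarrow> \<rho> k (0, 0) = k"
    "\<And>x. x \<in> S \<Longrightarrow> bij_betw (\<lambda>k. \<rho> k x) K {z. poly (F x) z = 0}"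
    using \<rho>'(1,2) \<rho>'(3)[unfolded K] by blast+
  have \<rho>_root: "poly (F x) (\<rho> k x) = 0" if "k \<in> K" "x \<in> S" for k x
    using bij_betw_apply[OF \<rho>(3)[OF that(2)] that(1)] by simp
  \<comment> \<open>Restricting to a path in the square turns uniqueness of root functions into a
    way of computing \<open>\<rho>\<close> along the sides.\<close>
  have unique: "\<rho> k (g y) = q y"
    if k: "k \<in> K" and g: "continuous_on {0..1} g" "g ` {0..1} \<subseteq> S" and y: "y \<in> {0..1}"
      and q: "continuous_on {0..1} q" "\<And>y. y \<in> {0..1} \<Longrightarrow> poly (F (g y)) (q y) = 0" "\<rho> k (g 0) = q 0"
    for k q and g :: "real \<Rightarrow> real \<times> real" and y
  proof -
    interpret pb: simple_root_family "{0..1}" "\<lambda>y. F (g y)" "Suc m" 1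
      by (rule fam.pullback[OF g])
    show ?thesis
    proof (rule pb.root_function_unique[of 0 y "\<lambda>y. \<rho> k (g y)" q])
      show "continuous_on {0..1} (\<lambda>y. \<rho> k (g y))" by (rule continuous_on_compose2[OF \<rho>(1)[OF k] g])
      show "poly (F (g x)) (\<rho> k (g x)) = 0" if "x \<in> {0..1}" for x
        using g(2) that by (intro \<rho>_root[OF k]) blast
    qed (use y q in auto)
  qed
  \<comment> \<open>Along \<open>t = 0\<close> and \<open>t = 1\<close> the polynomial is constantly
    \<open>Q\<close>, so roots cannot move; along \<open>s = 0\<close> it is \<open>f t\<close>,
    whose roots are the given strands.\<close>
  have \<rho>0: "\<rho> k (s, 0) = k" if "k \<in> K" "s \<in> {0..1}" for k s
    using that \<rho>(2) FQ(1) rootsQ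
    by (intro unique[of k "\<lambda>s. (s, 0)" s "\<lambda>s. k"]) (auto simp: S_def intro!: continuous_intros)
  have \<rho>c: "\<rho> k (0, t) = c k t" if "k \<in> K" "t \<in> {0..1}" for k t
  proof (rule unique[of k "\<lambda>t. (0, t)" t "c k"])
    show "poly (F (0, y)) (c k y) = 0" if "y \<in> {0..1}" for y
      using F0[OF that] roots_prod_linear[OF assms(1), of "\<lambda>k. c k y"] \<open>k \<in> K\<close> unfolding f_def by auto
  qed (use that ck[OF that(1)] \<rho>(2) in \<open>auto simp: S_def path_def intro!: continuous_intros\<close>)
  have \<rho>1: "\<rho> k (s, 1) = c k 1" if "k \<in> K" "s \<in> {0..1}" for k s
    using that \<rho>c[OF that(1), of 1] FQ(2) rootsQ ck(3)[OF that(1)]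
    by (intro unique[of k "\<lambda>s. (s, 1)" s "\<lambda>s. c k 1"]) (auto simp: S_def intro!: continuous_intros)
  define H where "H s k t = \<rho> k (s, t)" for s k t
  have H_braid: "geom_braid K (H s)" if s: "s \<in> {0..1}" for s
    unfolding geom_braid_def
  proof (intro conjI ballI impI)
    fix k assume k: "k \<in> K"
    show "path (H s k)"
      unfolding path_def H_def using s
      by (intro continuous_on_compose2[OF \<rho>(1)[OF k]] continuous_intros) (auto simp: S_def)
    show "H s k 0 = k" "H s k 1 \<in> K" using \<rho>0[OF k s] \<rho>1[OF k s] ck(3)[OF k] by (simp_all add: H_def)
  next
    fix t :: real and k l assume "t \<in> {0..1}" "k \<in> K" "l \<in> K" "k \<noteq> l"
    then show "H s k t \<noteq> H s l t"
      using bij_betw_imp_inj_on[OF \<rho>(3)[of "(s, t)"]] s by (auto simp: H_def S_def inj_on_def)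
  qed
  have "braid_isotopic K c (H 1)"
  proof (rule braid_isotopicI[where H = H])
    show "continuous_on ({0..1} \<times> {0..1}) (\<lambda>x. H (fst x) k (snd x))" if "k \<in> K" for k
      using \<rho>(1)[OF that] by (simp add: H_def S_def)
  qed (use H_braid \<rho>c \<rho>1 in \<open>auto simp: H_def\<close>)
  \<comment> \<open>On the side \<open>s = 1\<close> only the value coordinate of
    \<open>\<mu>\<close> varies, and the strands of \<open>H 1\<close> are the lifts of this loop
    under \<open>Q\<close>.\<close>
  define \<gamma> where "\<gamma> t = snd (snd (\<mu> t))" for t
  have \<mu>_eq: "\<mu> t = h (1, t)" if "t \<in> {0..1}" for t using h(4) that by simp
  have "path \<mu>" using homotopic_paths_imp_path[OF \<mu>(1)] by simp
  then have "path \<gamma>" unfolding path_def \<gamma>_def by (intro continuous_intros)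
  have blendQ: "blend f (fst (h (1, t)), fst (snd (h (1, t)))) = Q" if "t \<in> {0..1}" for t
    using blend_boundary[of f "(fst (\<mu> t), fst (snd (\<mu> t)))"] \<mu>(2)[OF that] f0 f1
    unfolding \<mu>_eq[OF that] by simp
  show ?thesis
  proof (rule that[of "H 1" \<gamma>])
    show "geom_braid K (H 1)" by (rule H_braid) simp
    show "pathstart \<gamma> = 0" "pathfinish \<gamma> = 0"
      using h_ends[of 1] \<mu>_eq[of 0] \<mu>_eq[of 1] by (simp_all add: pathstart_def pathfinish_def \<gamma>_def)
    show "\<gamma> t \<notin> critical_values Q" if "t \<in> {0..1}" for t
      using hS(3)[of "(1, t)"] that unfolding blendQ[OF that] by (simp add: S_def \<gamma>_def \<mu>_eq)
    show "poly Q (H 1 k t) = \<gamma> t" if "k \<in> K" "t \<in> {0..1}" for k t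
      using \<rho>_root[OF that(1), of "(1, t)"] that(2) unfolding F_def blendQ[OF that(2)]
      by (simp add: S_def \<gamma>_def \<mu>_eq H_def)
  qed fact+
qed

section \<open>Every braid is isotopic to a lift of a loop avoiding the critical values\<close>

theorem theorem1:
  fixes p :: "complex poly" and n :: nat and w0 :: complex
  assumes "n > 1"
    and "degree p = n"
    and "lead_coeff p = 1"
    and "card (critical_values p) = n - 1"
    and "w0 \<notin> critical_values p"
  shows "braid_monodromy_group p w0 = braid_group {z. poly p z = w0}"
proof -
  define K where "K = {z. poly p z = w0}"
  \<comment> \<open>Subtracting \<open>w0\<close> moves the base point to 0 and shifts all critical
    values by the same amount, so they remain distinct.\<close>
  define Q where "Q = p - [:w0:]"
  obtain m where m: "n = Suc m" "m > 0" using assms(1) by (cases n) auto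
  have degQ: "degree Q = Suc m" unfolding Q_def using assms(2) m by (subst degree_diff_const) auto
  have leadQ: "lead_coeff Q = 1"
    using assms(2,3) m degQ unfolding Q_def by (simp add: coeff_pCons)
  have rootsQ: "{z. poly Q z = 0} = K" by (auto simp: Q_def K_def)
  have "card K = Suc m"
    using card_roots_diff_const_iff[of p w0] assms(2,5) m rootsQ unfolding Q_def by simp
  then have "finite K" by (metis card.infinite nat.distinct(1))
  have "Q \<noteq> 0" using degQ by auto
  then have "rsquarefree Q"
    using card_roots_eq_degree_iff[of Q] degQ \<open>card K = Suc m\<close> rootsQ by (auto simp: rsquarefree_roots)
  then have Q: "Q = (\<Prod>k\<in>K. [:- k, 1:])"
    using complex_poly_decompose_rsquarefree[of Q] leadQ rootsQ by simp
  have cvQ: "critical_values Q = (\<lambda>w. w - w0) ` critical_values p"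
    unfolding critical_values_def critical_points_def image_image Q_def pderiv_diff_const by simp
  then have goodQ: "card (critical_values (\<Prod>k\<in>K. [:- k, 1:])) = m"
    using assms(4) m Q by (simp add: card_image)
  have "braid_class K b \<in> braid_monodromy_group p w0" if b: "geom_braid K b" for b
  proof -
    obtain c where c: "geom_braid K c" "braid_isotopic K b c"
      "\<And>t. t \<in> {0..1} \<Longrightarrow> card (critical_values (\<Prod>k\<in>K. [:- c k t, 1:])) = m"
      using isotopic_to_generic_braid[OF \<open>finite K\<close> \<open>card K = Suc m\<close> m(2) b goodQ] by blast
    obtain d \<gamma> where d: "geom_braid K d" "braid_isotopic K c d"
      and \<gamma>: "path \<gamma>" "pathstart \<gamma> = 0" "pathfinish \<gamma> = 0" "\<And>t. t \<in> {0..1} \<Longrightarrow> \<gamma> t \<notin> critical_values Q"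
      and lift: "\<And>k t. k \<in> K \<Longrightarrow> t \<in> {0..1} \<Longrightarrow> poly Q (d k t) = \<gamma> t"
      using isotopic_to_lift[OF \<open>finite K\<close> \<open>card K = Suc m\<close> m(2) c(1,3) Q] by blast
    define lam where "lam t = w0 + \<gamma> t" for t
    have "path lam" using \<gamma>(1) unfolding path_def lam_def by (intro continuous_intros)
    moreover have "pathstart lam = w0" "pathfinish lam = w0"
      using \<gamma>(2,3) by (auto simp: lam_def pathstart_def pathfinish_def)
    moreover have "path_image lam \<inter> critical_values p = {}"
      using \<gamma>(4) unfolding cvQ by (force simp: path_image_def lam_def)
    moreover have "is_lift p K lam d"
      using d(1) lift unfolding is_lift_def geom_braid_def lam_def Q_def by (auto simp: algebra_simps)
    ultimately have "braid_class K d \<in> braid_monodromy_group p w0"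
      using d(1) unfolding braid_monodromy_group_def Let_def K_def[symmetric] by blast
    moreover have "braid_class K b = braid_class K d"
      by (rule braid_class_eq[OF braid_isotopic_trans[OF c(2) d(2)]])
    ultimately show ?thesis by simp
  qed
  then have "braid_group K \<subseteq> braid_monodromy_group p w0" by (auto simp: braid_group_def)
  moreover have "braid_monodromy_group p w0 \<subseteq> braid_group K"
    by (auto simp: braid_monodromy_group_def braid_group_def K_def Let_def)
  ultimately show ?thesis by (simp add: K_def)
qed

end
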